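(* For every $n\ge2$ the Jacobi–Sobolev polynomials satisfy the ladder equations $$A_{4,n}(x)S_n(x)+B_{4,n}(x)S_n'(x)=S_{n-1}(x),$$ $$C_{4,n}(x)S_{n-1}(x)+D_{4,n}(x)S_{n-1}'(x)=S_n(x),$$ where $$A_{4,n}=\frac{q_{2,n}}{q_{1,n}},\quad B_{4,n}=\frac{q_{0,n}}{q_{1,n}},\quad C_{4,n}=\frac{q_{3,n}}{q_{4,n}},\quad D_{4,n}=\frac{q_{0,n}}{q_{4,n}},$$ and $q_{0,n},\dots,q_{4,n}$ are the polynomials $$\begin{aligned} q_{0,n}(x)&=(1-x^2)\Delta_n(x), &\deg q_{0,n}&=2d+2,\\ q_{1,n}(x)&=B_{3,n}(x)A_{2,n}(x)-A_{3,n}(x)B_{2,n}(x), &\deg q_{1,n}&=2d,\\ q_{2,n}(x)&=(1-x^2)\rho'(x)\delta_n(x)+B_{3,n}(x)C_{2,n}(x)-A_{3,n}(x)D_{2,n}(x), &\deg q_{2,n}&=2d+1,\\ q_{3,n}(x)&=(1-x^2)\rho'(x)\delta_n(x)+C_{3,n}(x)B_{2,n}(x)-D_{3,n}(x)A_{2,n}(x), &\deg q_{3,n}&=2d+1,\\ q_{4,n}(x)&=C_{3,n}(x)D_{2,n}(x)-D_{3,n}(x)C_{2,n}(x), &\deg q_{4,n}&=2d. \end{aligned}$$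
   Context: Let $\alpha,\beta>-1$, $d\mu^{\alpha,\beta}(x)=(1-x)^\alpha(1+x)^\beta dx$ on $[-1,1]$; let $P_n=P_n^{\alpha,\beta}$ be the monic Jacobi polynomials and $h_n=\int_{-1}^1P_n^2\,d\mu^{\alpha,\beta}$. Let $N,d_j$ be nonnegative integers, $\lambda_{j,k}\ge0$ for $1\le j\le N$, $0\le k\le d_j$, $c_1,\dots,c_N\in\mathbb R\setminus(-1,1)$ distinct, $I_+=\{(j,k):\lambda_{j,k}>0\}$; assume $(j,d_j)\in I_+$ for all $j$ and $d_1\le\dots\le d_N$. Put $d=\sum_{j=1}^N(d_j+1)$. $S_n$ is the monic polynomial of degree $n$ with $\langle x^i,S_n\rangle_{\mathsf s}=0$ for $0\le i<n$, where $$\langle f,g\rangle_{\mathsf s}=\int_{-1}^1fg\,d\mu^{\alpha,\beta}+\sum_{(j,k)\in I_+}\lambda_{j,k}f^{(k)}(c_j)g^{(k)}(c_j).$$ Notation. $Q_k(x,y;f)=\sum_{\nu=0}^k\frac{f^{(\nu)}(y)}{\nu!}(x-y)^\nu$; $\rho(x)=\prod_{j=1}^N(x-c_j)^{d_j+1}$; $\rho_{j,k}(x)=\rho(x)/(x-c_j)^{k+1}$. $$\gamma_{1,n}=\frac{\beta^2-\alpha^2}{(2n+\alpha+\beta)(2n+\alpha+\beta+2)},\quad \gamma_{2,n}=\frac{4n(n+\alpha)(n+\beta)(n+\alpha+\beta)}{(2n+\alpha+\beta)^2((2n+\alpha+\beta)^2-1)},$$ $$\widehat a_n(x)=-\frac{n((2n+\alpha+\beta)x+\beta-\alpha)}{2n+\alpha+\beta},\quad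 \widehat b_n=\frac{4n(n+\alpha)(n+\beta)(n+\alpha+\beta)}{(2n+\alpha+\beta)^2(2n+\alpha+\beta-1)},$$ $$\widehat c_n(x)=\frac{(n+\alpha+\beta)((2n+\alpha+\beta)x+\alpha-\beta)}{2n+\alpha+\beta},\quad \widehat d_n=-(2n+\alpha+\beta-1).$$ (For $n=1$ the common factor $1+\alpha+\beta$ in $\gamma_{2,1}$ and $\widehat b_1$ is cancelled, so these are defined also if $\alpha+\beta=-1$.) For $n\ge1$: $$A_{2,n}(x)=\rho(x)-\sum_{(j,k)\in I_+}\frac{k!\lambda_{j,k}S_n^{(k)}(c_j)}{h_{n-1}}Q_k(x,c_j;P_{n-1})\rho_{j,k}(x),\quad B_{2,n}(x)=\sum_{(j,k)\in I_+}\frac{k!\lambda_{j,k}S_n^{(k)}(c_j)}{h_{n-1}}Q_k(x,c_j;P_n)\rho_{j,k}(x),$$ $$A_{3,n}=(1-x^2)A_{2,n}'+\widehat a_nA_{2,n}+\widehat d_nB_{2,n},\quad B_{3,n}=(1-x^2)B_{2,n}'+\widehat b_nA_{2,n}+\widehat c_nB_{2,n}.$$ For $n\ge2$ and $i\in\{2,3\}$: $$C_{i,n}=-\frac{B_{i,n-1}}{\gamma_{2,n-1}},\quad D_{i,n}=A_{i,n-1}+B_{i,n-1}\frac{x-\gamma_{1,n-1}}{\gamma_{2,n-1}}.$$ $\Delta_n=A_{2,n}D_{2,n}-C_{2,n}B_{2,n}$, and $\delta_n=\Delta_n/\rho$ (a polynomial of degree $d$, since $\rho$ divides $\Delta_n$).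 *)

theory Defs
  imports
    "HOL-Analysis.Analysis"
    "HOL-Computational_Algebra.Polynomial_Factorial"
begin

definition monic_orthogonal_poly :: "(real poly \<Rightarrow> real poly \<Rightarrow> real) \<Rightarrow> nat \<Rightarrow> real poly" where
  "monic_orthogonal_poly ip n =
     (THE p. degree p = n \<and> lead_coeff p = 1 \<and> (\<forall>i<n. ip (monom 1 i) p = 0))"

abbreviation poly_deriv_at :: "nat \<Rightarrow> real poly \<Rightarrow> real \<Rightarrow> real" where
  "poly_deriv_at k f y \<equiv> poly ((pderiv ^^ k) f) y"

text \<open>The Taylor polynomial \<open>Q\<^sub>k(x, y; f)\<close>, as a polynomial in \<open>x\<close>.\<close>

definition taylor_poly :: "nat \<Rightarrow> real \<Rightarrow> real poly \<Rightarrow> real poly" where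
  "taylor_poly k y f = (\<Sum>\<nu>\<le>k. smult (poly_deriv_at \<nu> f y / fact \<nu>) ([:- y, 1:] ^ \<nu>))"

context
  fixes \<alpha> \<beta> :: real
begin

definition jacobi_measure :: "real measure" where
  "jacobi_measure =
     density lborel (\<lambda>x. ennreal (indicator {-1..1} x * ((1 - x) powr \<alpha> * (1 + x) powr \<beta>)))"

definition jacobi_inner :: "real poly \<Rightarrow> real poly \<Rightarrow> real" where
  "jacobi_inner f g = (\<integral>x. poly f x * poly g x \<partial>jacobi_measure)"

definition jacobi_poly :: "nat \<Rightarrow> real poly" where
  "jacobi_poly = monic_orthogonal_poly jacobi_inner"

definition jacobi_h :: "nat \<Rightarrow> real" where
  "jacobi_h n = jacobi_inner (jacobi_poly n) (jacobi_poly n)"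

definition gamma1 :: "nat \<Rightarrow> real" where
  "gamma1 n = (\<beta>\<^sup>2 - \<alpha>\<^sup>2) / ((2 * real n + \<alpha> + \<beta>) * (2 * real n + \<alpha> + \<beta> + 2))"

text \<open>
  For \<open>n = 1\<close> numerator and denominator of the general expressions for \<open>gamma2\<close> and \<open>b_hat\<close>
  share the factor \<open>1 + \<alpha> + \<beta>\<close>, which may vanish; there it is cancelled.
\<close>

definition gamma2 :: "nat \<Rightarrow> real" where
  "gamma2 n =
     (if n = 1 then 4 * (1 + \<alpha>) * (1 + \<beta>) / ((2 + \<alpha> + \<beta>)\<^sup>2 * (3 + \<alpha> + \<beta>))
      else 4 * real n * (real n + \<alpha>) * (real n + \<beta>) * (real n + \<alpha> + \<beta>) /
             ((2 * real n + \<alpha> + \<beta>)\<^sup>2 * ((2 * real n + \<alpha> + \<beta>)\<^sup>2 - 1)))"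

definition a_hat :: "nat \<Rightarrow> real poly" where
  "a_hat n = smult (- (real n / (2 * real n + \<alpha> + \<beta>))) [:\<beta> - \<alpha>, 2 * real n + \<alpha> + \<beta>:]"

definition b_hat :: "nat \<Rightarrow> real" where
  "b_hat n =
     (if n = 1 then 4 * (1 + \<alpha>) * (1 + \<beta>) / (2 + \<alpha> + \<beta>)\<^sup>2
      else 4 * real n * (real n + \<alpha>) * (real n + \<beta>) * (real n + \<alpha> + \<beta>) /
             ((2 * real n + \<alpha> + \<beta>)\<^sup>2 * (2 * real n + \<alpha> + \<beta> - 1)))"

definition c_hat :: "nat \<Rightarrow> real poly" where
  "c_hat n =
     smult ((real n + \<alpha> + \<beta>) / (2 * real n + \<alpha> + \<beta>)) [:\<alpha> - \<beta>, 2 * real n + \<alpha> + \<beta>:]"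

definition d_hat :: "nat \<Rightarrow> real" where
  "d_hat n = - (2 * real n + \<alpha> + \<beta> - 1)"

end

abbreviation one_minus_x2 :: "real poly" where
  "one_minus_x2 \<equiv> [:1, 0, -1:]"

text \<open>
  The mass points are \<open>c j\<close> and the highest derivatives at them \<open>ds j\<close>, for \<open>1 \<le> j \<le> N\<close>; the
  coefficients are \<open>lam j k\<close> for \<open>k \<le> ds j\<close>.  Values at other indices are irrelevant.
\<close>

context
  fixes \<alpha> \<beta> :: real and N :: nat and ds :: "nat \<Rightarrow> nat"
    and c :: "nat \<Rightarrow> real" and lam :: "nat \<Rightarrow> nat \<Rightarrow> real"
begin

definition I_plus :: "(nat \<times> nat) set" where
  "I_plus = {(j, k). 1 \<le> j \<and> j \<le> N \<and> k \<le> ds j \<and> lam j k > 0}"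

definition sobolev_inner :: "real poly \<Rightarrow> real poly \<Rightarrow> real" where
  "sobolev_inner f g = jacobi_inner \<alpha> \<beta> f g +
     (\<Sum>(j, k)\<in>I_plus. lam j k * poly_deriv_at k f (c j) * poly_deriv_at k g (c j))"

definition sobolev_poly :: "nat \<Rightarrow> real poly" where
  "sobolev_poly = monic_orthogonal_poly sobolev_inner"

definition d_total :: nat where
  "d_total = (\<Sum>j=1..N. ds j + 1)"

definition rho :: "real poly" where
  "rho = (\<Prod>j=1..N. [:- c j, 1:] ^ (ds j + 1))"

definition rho_quot :: "nat \<Rightarrow> nat \<Rightarrow> real poly" where
  "rho_quot j k = rho div [:- c j, 1:] ^ (k + 1)"

definition A2 :: "nat \<Rightarrow> real poly" where
  "A2 n = rho - (\<Sum>(j, k)\<in>I_plus.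
     smult (fact k * lam j k * poly_deriv_at k (sobolev_poly n) (c j) / jacobi_h \<alpha> \<beta> (n - 1))
       (taylor_poly k (c j) (jacobi_poly \<alpha> \<beta> (n - 1)) * rho_quot j k))"

definition B2 :: "nat \<Rightarrow> real poly" where
  "B2 n = (\<Sum>(j, k)\<in>I_plus.
     smult (fact k * lam j k * poly_deriv_at k (sobolev_poly n) (c j) / jacobi_h \<alpha> \<beta> (n - 1))
       (taylor_poly k (c j) (jacobi_poly \<alpha> \<beta> n) * rho_quot j k))"

definition A3 :: "nat \<Rightarrow> real poly" where
  "A3 n = one_minus_x2 * pderiv (A2 n) + a_hat \<alpha> \<beta> n * A2 n + smult (d_hat \<alpha> \<beta> n) (B2 n)"

definition B3 :: "nat \<Rightarrow> real poly" where
  "B3 n = one_minus_x2 * pderiv (B2 n) + smult (b_hat \<alpha> \<beta> n) (A2 n) + c_hat \<alpha> \<beta> n * B2 n"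

definition C2 :: "nat \<Rightarrow> real poly" where
  "C2 n = - smult (1 / gamma2 \<alpha> \<beta> (n - 1)) (B2 (n - 1))"

definition C3 :: "nat \<Rightarrow> real poly" where
  "C3 n = - smult (1 / gamma2 \<alpha> \<beta> (n - 1)) (B3 (n - 1))"

definition D2 :: "nat \<Rightarrow> real poly" where
  "D2 n = A2 (n - 1) +
     B2 (n - 1) * smult (1 / gamma2 \<alpha> \<beta> (n - 1)) [:- gamma1 \<alpha> \<beta> (n - 1), 1:]"

definition D3 :: "nat \<Rightarrow> real poly" where
  "D3 n = A3 (n - 1) +
     B3 (n - 1) * smult (1 / gamma2 \<alpha> \<beta> (n - 1)) [:- gamma1 \<alpha> \<beta> (n - 1), 1:]"

definition Delta :: "nat \<Rightarrow> real poly" where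
  "Delta n = A2 n * D2 n - C2 n * B2 n"

definition delta :: "nat \<Rightarrow> real poly" where
  "delta n = Delta n div rho"

definition q0 :: "nat \<Rightarrow> real poly" where
  "q0 n = one_minus_x2 * Delta n"

definition q1 :: "nat \<Rightarrow> real poly" where
  "q1 n = B3 n * A2 n - A3 n * B2 n"

definition q2 :: "nat \<Rightarrow> real poly" where
  "q2 n = one_minus_x2 * pderiv rho * delta n + B3 n * C2 n - A3 n * D2 n"

definition q3 :: "nat \<Rightarrow> real poly" where
  "q3 n = one_minus_x2 * pderiv rho * delta n + C3 n * B2 n - D3 n * A2 n"

definition q4 :: "nat \<Rightarrow> real poly" where
  "q4 n = C3 n * D2 n - D3 n * C2 n"

text \<open>The ladder coefficients, as elements of the field of rational functions over the reals.\<close>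

definition A4 :: "nat \<Rightarrow> real poly fract" where
  "A4 n = Fract (q2 n) (q1 n)"

definition B4 :: "nat \<Rightarrow> real poly fract" where
  "B4 n = Fract (q0 n) (q1 n)"

definition C4 :: "nat \<Rightarrow> real poly fract" where
  "C4 n = Fract (q3 n) (q4 n)"

definition D4 :: "nat \<Rightarrow> real poly fract" where
  "D4 n = Fract (q0 n) (q4 n)"

end

end

theory Submission
  imports Defs
begin

text \<open>
  Expanding \<open>S\<^sub>n\<close> in the Jacobi polynomials \<open>P\<^sub>i\<close> expresses \<open>S\<^sub>n - P\<^sub>n\<close> through differentiated
  Christoffel--Darboux kernels.  Taylor expansion at \<open>y\<close> commutes with multiplication by \<open>x\<close> up to a
  multiple of \<open>(x - y)\<^sup>k\<^sup>+\<^sup>1\<close>, so these kernels can be summed by induction along the three-term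
  recurrence, which gives \<open>\<rho> S\<^sub>n = A\<^sub>2 P\<^sub>n + B\<^sub>2 P\<^sub>n\<^sub>-\<^sub>1\<close>; differentiating and inserting the structure
  relations of the \<open>P\<^sub>n\<close> gives \<open>(1 - x\<^sup>2) (\<rho> S\<^sub>n)' = A\<^sub>3 P\<^sub>n + B\<^sub>3 P\<^sub>n\<^sub>-\<^sub>1\<close>.  The same holds for \<open>S\<^sub>n\<^sub>-\<^sub>1\<close>
  with \<open>C\<^sub>i\<close>, \<open>D\<^sub>i\<close>, and eliminating \<open>P\<^sub>n\<close> and \<open>P\<^sub>n\<^sub>-\<^sub>1\<close> yields the ladder equations.  Here \<open>\<rho>\<close> divides
  the determinant \<open>\<Delta>\<^sub>n\<close> because \<open>P\<^sub>n\<close> and \<open>P\<^sub>n\<^sub>-\<^sub>1\<close> are coprime.  For the degrees, the coefficient of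
  \<open>x\<^sup>d\<^sup>-\<^sup>1\<close> in \<open>B\<^sub>2\<close> is \<open>(\<langle>S\<^sub>n, S\<^sub>n\<rangle> - h\<^sub>n) / h\<^sub>n\<^sub>-\<^sub>1\<close>, which makes every leading coefficient a nonzero
  multiple of a ratio of squared norms.
\<close>

subsection \<open>Monic orthogonal polynomials\<close>

text \<open>Shared by the Jacobi and the Sobolev product. The latter does not depend on
  \<open>f * g\<close> alone, so only the theory that does without a symmetric multiplication by x
  belongs here.\<close>

locale poly_inner =
  fixes ip :: "real poly \<Rightarrow> real poly \<Rightarrow> real"
  assumes add_left: "ip (f + g) p = ip f p + ip g p"
    and smult_left: "ip (smult a f) g = a * ip f g"
    and commute: "ip f g = ip g f"
    and pos: "f \<noteq> 0 \<Longrightarrow> ip f f > 0"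
begin

abbreviation P :: "nat \<Rightarrow> real poly" where
  "P \<equiv> monic_orthogonal_poly ip"

lemma zero_left [simp]: "ip 0 g = 0"
  using smult_left[of 0 0 g] by simp

lemma diff_left: "ip (f - g) p = ip f p - ip g p"
  using add_left[of "f - g" g p] by simp

lemma sum_left: "ip (\<Sum>i\<in>A. f i) g = (\<Sum>i\<in>A. ip (f i) g)"
  by (induction A rule: infinite_finite_induct) (simp_all add: add_left)

lemma eq_0_if_ip_self_eq_0: "ip f f = 0 \<Longrightarrow> f = 0"
  using pos[of f] by fastforce

text \<open>The monic \<open>Q j\<close> span the polynomials of degree below n; the induction
  strips off the top coefficient. Bounding coefficients rather than the degree makes n = 0 force f =
  0.\<close>

lemma ip_eq_0_if_orthogonal_to_monic:
  assumes "\<And>j. j < n \<Longrightarrow> coeff (Q j) j = 1"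
    and "\<And>i j. j < n \<Longrightarrow> j < i \<Longrightarrow> coeff (Q j) i = 0"
    and "\<And>j. j < n \<Longrightarrow> ip (Q j) g = 0"
    and "\<And>i. n \<le> i \<Longrightarrow> coeff f i = 0"
  shows "ip f g = 0"
  using assms
proof (induction n arbitrary: f)
  case 0
  then have "f = 0" by (simp add: poly_eq_iff)
  then show ?case by simp
next
  case (Suc n)
  let ?r = "f - smult (coeff f n) (Q n)"
  have r: "coeff ?r i = 0" if "n \<le> i" for i
    using Suc.prems(1,2,4) that by (cases "i = n") auto
  have "ip ?r g = 0"
    by (rule Suc.IH[OF Suc.prems(1) Suc.prems(2) Suc.prems(3) r]) simp_all
  then show ?case
    using Suc.prems(3)[of n] by (simp add: diff_left smult_left)
qed

text \<open>Gram-Schmidt: strong induction provides an orthogonal family of lower degrees, and the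
  projection of x^n to its span is subtracted from x^n.\<close>

lemma ex_monic_orthogonal_poly:
  "\<exists>p. degree p = n \<and> lead_coeff p = 1 \<and> (\<forall>i<n. ip (monom 1 i) p = 0)"
proof (induction n rule: less_induct)
  case (less n)
  then have "\<forall>m. \<exists>p. m < n \<longrightarrow> degree p = m \<and> lead_coeff p = 1 \<and> (\<forall>i<m. ip (monom 1 i) p = 0)"
    by blast
  then obtain Q where Q:
    "\<And>m. m < n \<Longrightarrow> degree (Q m) = m \<and> lead_coeff (Q m) = 1 \<and> (\<forall>i<m. ip (monom 1 i) (Q m) = 0)"
    unfolding choice_iff by blast
  have Q_lead: "coeff (Q j) j = 1" and Q_high: "j < i \<Longrightarrow> coeff (Q j) i = 0" if "j < n" for i j
    using Q[OF that] by (metis, metis coeff_eq_0)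
  have low: "ip (Q i) (Q j) = 0" if "i < j" "j < n" for i j
  proof (rule ip_eq_0_if_orthogonal_to_monic[where Q = "monom 1" and n = j])
    show "coeff (Q i) k = 0" if "j \<le> k" for k
      using Q_high[of i k] that \<open>i < j\<close> \<open>j < n\<close> by simp
  qed (use Q[OF \<open>j < n\<close>] in auto)
  have ortho: "ip (Q i) (Q j) = 0" if "i \<noteq> j" "i < n" "j < n" for i j
    using low[of i j] low[of j i] commute[of "Q i" "Q j"] that by linarith
  have self: "ip (Q j) (Q j) \<noteq> 0" if "j < n" for j
    using eq_0_if_ip_self_eq_0[of "Q j"] Q_lead[OF that] by auto
  define s where "s = (\<Sum>i<n. smult (ip (monom 1 n) (Q i) / ip (Q i) (Q i)) (Q i))"
  define p where "p = monom 1 n - s"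
  have s_high: "coeff s i = 0" if "n \<le> i" for i
    unfolding s_def coeff_sum using that by (intro sum.neutral) (simp add: Q_high)
  have p_lead: "coeff p n = 1" and p_high: "\<And>i. n < i \<Longrightarrow> coeff p i = 0"
    by (simp_all add: p_def s_high)
  have deg: "degree p = n"
    by (rule antisym[OF degree_le le_degree]) (use p_lead p_high in auto)
  have "ip p (Q j) = 0" if "j < n" for j
  proof -
    have "ip s (Q j) = (\<Sum>i<n. if i = j then ip (monom 1 n) (Q j) else 0)"
      unfolding s_def sum_left by (rule sum.cong) (use that self ortho in \<open>auto simp: smult_left\<close>)
    then show ?thesis using that by (simp add: p_def diff_left)
  qed
  then have "ip (Q j) p = 0" if "j < n" for j
    using that commute[of p] by simp
  note ortho_p = this
  have "ip (monom 1 i) p = 0" if "i < n" for i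
    by (rule ip_eq_0_if_orthogonal_to_monic[where Q = Q and n = n, OF Q_lead Q_high ortho_p])
      (use that in simp_all)
  with deg p_lead show ?case by auto
qed

lemma ip_low_eq_0:
  assumes "\<And>i. i < n \<Longrightarrow> ip (monom 1 i) p = 0" and "\<And>i. n \<le> i \<Longrightarrow> coeff f i = 0"
  shows "ip f p = 0"
  by (rule ip_eq_0_if_orthogonal_to_monic[where Q = "monom 1" and n = n]) (use assms in auto)

text \<open>Two candidates differ by a polynomial of degree below n, which is orthogonal to both and
  so to itself. This uniqueness discharges the \<open>THE\<close> of the definition.\<close>

lemma monic_orthogonal_poly_spec:
  "degree (P n) = n \<and> lead_coeff (P n) = 1 \<and> (\<forall>i<n. ip (monom 1 i) (P n) = 0)"
proof -
  have "p = q" if p: "degree p = n \<and> lead_coeff p = 1 \<and> (\<forall>i<n. ip (monom 1 i) p = 0)"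
    and q: "degree q = n \<and> lead_coeff q = 1 \<and> (\<forall>i<n. ip (monom 1 i) q = 0)" for p q
  proof -
    have "coeff (p - q) i = 0" if "n \<le> i" for i
      using p q that by (cases "i = n") (auto simp: coeff_eq_0)
    then have "ip (p - q) p = 0" "ip (p - q) q = 0"
      using ip_low_eq_0[of n p "p - q"] ip_low_eq_0[of n q "p - q"] p q by simp_all
    then have "ip (p - q) (p - q) = 0"
      using commute[of p "p - q"] commute[of q "p - q"] diff_left[of p q "p - q"] by simp
    then show ?thesis using eq_0_if_ip_self_eq_0 by fastforce
  qed
  then show ?thesis
    unfolding monic_orthogonal_poly_def
    using theI'[of "\<lambda>p. degree p = n \<and> lead_coeff p = 1 \<and> (\<forall>i<n. ip (monom 1 i) p = 0)"]
      ex_monic_orthogonal_poly[of n] by blast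
qed

lemma degree_P [simp]: "degree (P n) = n"
  using monic_orthogonal_poly_spec by blast

lemma coeff_P_self [simp]: "coeff (P n) n = 1"
  using monic_orthogonal_poly_spec[of n] by simp

lemma coeff_P_high [simp]: "n < i \<Longrightarrow> coeff (P n) i = 0"
  by (simp add: coeff_eq_0)

lemma P_neq_0 [simp]: "P n \<noteq> 0"
  by (metis coeff_0 coeff_P_self zero_neq_one)

lemma P_0: "P 0 = 1"
  using degree_0_id[of "P 0"] coeff_P_self[of 0] by (simp add: one_pCons)

lemma P_1: "\<exists>u. P (Suc 0) = [:u, 1:]"
proof
  show "P (Suc 0) = [:coeff (P (Suc 0)) 0, 1:]"
    by (rule poly_eqI) (simp add: coeff_pCons split: nat.split)
qed

lemma ip_P: "(\<And>i. n \<le> i \<Longrightarrow> coeff f i = 0) \<Longrightarrow> ip f (P n) = 0"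
  using ip_low_eq_0[of n "P n" f] monic_orthogonal_poly_spec[of n] by simp

lemma ip_P_P: "i \<noteq> j \<Longrightarrow> ip (P i) (P j) = 0"
  using ip_P[of j "P i"] ip_P[of i "P j"] commute[of "P i" "P j"] by (cases "i < j") auto

lemma ip_P_pos: "ip (P n) (P n) > 0"
  by (simp add: pos)

text \<open>\<open>f - P n\<close> has degree below n, hence is orthogonal to
  \<open>P n\<close>.\<close>

lemma ip_P_monic:
  assumes "coeff f n = 1" "\<And>i. n < i \<Longrightarrow> coeff f i = 0"
  shows "ip f (P n) = ip (P n) (P n)"
proof -
  have "ip (f - P n) (P n) = 0"
    by (rule ip_P) (use assms in \<open>auto simp: le_less\<close>)
  then show ?thesis by (simp add: diff_left)
qed

text \<open>\<open>f\<close> lies in the span of the \<open>P j\<close> with j < n, so it is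
  orthogonal to itself.\<close>

lemma eq_0_if_orthogonal_to_P:
  assumes "\<And>i. n \<le> i \<Longrightarrow> coeff f i = 0" and "\<And>j. j < n \<Longrightarrow> ip f (P j) = 0"
  shows "f = 0"
proof -
  have "ip f f = 0"
    by (rule ip_eq_0_if_orthogonal_to_monic[where Q = P and n = n, OF _ _ _ assms(1)])
      (use assms(2) commute[of f] in auto)
  then show ?thesis by (rule eq_0_if_ip_self_eq_0)
qed

lemma P_expansion:
  assumes "\<And>i. n \<le> i \<Longrightarrow> coeff f i = 0"
  shows "f = (\<Sum>i<n. smult (ip f (P i) / ip (P i) (P i)) (P i))"
proof -
  let ?s = "\<Sum>i<n. smult (ip f (P i) / ip (P i) (P i)) (P i)"
  have "f - ?s = 0"
  proof (rule eq_0_if_orthogonal_to_P)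
    show "coeff (f - ?s) i = 0" if "n \<le> i" for i
      using assms that by (auto simp: coeff_sum intro!: sum.neutral)
    show "ip (f - ?s) (P j) = 0" if "j < n" for j
    proof -
      have "ip ?s (P j) = (\<Sum>i<n. if i = j then ip f (P j) else 0)"
        unfolding sum_left using ip_P_pos[of j]
        by (intro sum.cong) (auto simp: smult_left ip_P_P)
      then show ?thesis using that by (simp add: diff_left)
    qed
  qed
  then show ?thesis by simp
qed

end

subsection \<open>Recurrence and structure relations from the Pearson equation\<close>

text \<open>\<open>L\<close> stands for integration against the Jacobi weight w, and
  \<open>pearson\<close> for integrating ((1 - x^2) w f)' with vanishing boundary terms. From these
  properties the recurrences follow algebraically.\<close>

locale jacobi_functional =
  fixes \<alpha> \<beta> :: real and L :: "real poly \<Rightarrow> real"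
  assumes alpha: "\<alpha> > -1" and beta: "\<beta> > -1"
    and L_add: "L (f + g) = L f + L g"
    and L_smult: "L (smult a f) = a * L f"
    and L_pos: "f \<noteq> 0 \<Longrightarrow> L (f * f) > 0"
    and pearson: "L (one_minus_x2 * pderiv f) = L ([:\<alpha> - \<beta>, \<alpha> + \<beta> + 2:] * f)"
begin

sublocale poly_inner "\<lambda>f g. L (f * g)"
  by unfold_locales (simp_all add: L_add L_smult L_pos distrib_right, simp add: mult.commute)

lemma L_diff: "L (f - g) = L f - L g"
  using L_add[of "f - g" g] by simp

abbreviation h :: "nat \<Rightarrow> real" where
  "h n \<equiv> L (P n * P n)"

text \<open>
  By the Pearson equation this operator is symmetric for \<open>L\<close>, so each \<open>P n\<close> is an
  eigenvector; comparing coefficients determines the subleading coefficients of \<open>P n\<close>, and with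
  them \<open>gamma1\<close> and \<open>gamma2\<close>.
\<close>

definition jacobi_op :: "real poly \<Rightarrow> real poly" where
  "jacobi_op f = one_minus_x2 * pderiv (pderiv f) + [:\<beta> - \<alpha>, - (\<alpha> + \<beta> + 2):] * pderiv f"

text \<open>On monomials the operator is triangular: it does not raise degrees, and its diagonal
  carries the eigenvalues.\<close>

lemma coeff_jacobi_op:
  "coeff (jacobi_op f) k =
     (real k + 2) * (real k + 1) * coeff f (k + 2) + (\<beta> - \<alpha>) * (real k + 1) * coeff f (k + 1)
     - real k * (real k + \<alpha> + \<beta> + 1) * coeff f k"
  by (auto simp: jacobi_op_def coeff_pderiv coeff_pCons algebra_simps split: nat.split)

text \<open>The Pearson equation for \<open>pderiv f * g\<close>. The right-hand side is symmetric
  in f and g, which makes the operator symmetric.\<close>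

lemma L_jacobi_op: "L (jacobi_op f * g) = - L (one_minus_x2 * (pderiv f * pderiv g))"
proof -
  have "one_minus_x2 * pderiv (pderiv f * g) =
      jacobi_op f * g + [:\<alpha> - \<beta>, \<alpha> + \<beta> + 2:] * (pderiv f * g) + one_minus_x2 * (pderiv f * pderiv g)"
  proof -
    have "[:\<beta> - \<alpha>, - (\<alpha> + \<beta> + 2):] = - [:\<alpha> - \<beta>, \<alpha> + \<beta> + 2:]" by simp
    then show ?thesis
      unfolding jacobi_op_def pderiv_mult by (simp only: algebra_simps)
  qed
  then show ?thesis
    using pearson[of "pderiv f * g"] by (simp only: L_add)
qed

lemma L_jacobi_op_commute: "L (jacobi_op f * g) = L (f * jacobi_op g)"
  using L_jacobi_op[of f g] L_jacobi_op[of g f] by (simp add: mult.commute)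

lemma jacobi_op_P: "jacobi_op (P n) = - smult (real n * (real n + \<alpha> + \<beta> + 1)) (P n)"
proof -
  \<comment> \<open>The defect of the eigenvalue equation has degree below n because the top
    coefficients cancel. Symmetry moves the operator onto \<open>R\<close>, so both parts of
    \<open>L (R * R)\<close> pair \<open>P n\<close> with a lower degree.\<close>
  define R where "R = jacobi_op (P n) + smult (real n * (real n + \<alpha> + \<beta> + 1)) (P n)"
  have R: "coeff R i = 0" if "n \<le> i" for i
    using that by (cases "i = n") (simp_all add: R_def coeff_jacobi_op)
  have "L (R * P n) = 0" by (rule ip_P) (rule R)
  moreover have "L (jacobi_op R * P n) = 0"
    by (rule ip_P) (simp add: coeff_jacobi_op R)
  moreover have "L (R * R) = L (jacobi_op R * P n) + real n * (real n + \<alpha> + \<beta> + 1) * L (R * P n)"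
    using L_jacobi_op_commute[of R "P n"] commute[of R "jacobi_op (P n)"]
    by (subst (2) R_def) (simp add: distrib_left L_add L_smult)
  ultimately have "R = 0" by (intro eq_0_if_ip_self_eq_0) simp
  then show ?thesis by (simp add: R_def eq_neg_iff_add_eq_0)
qed

text \<open>The coefficient of x^k in the eigenvalue equation; the factor on the left is the
  difference of the eigenvalues for n and k.\<close>

lemma coeff_P_recurrence:
  "(real n - real k) * (real n + real k + \<alpha> + \<beta> + 1) * coeff (P n) k =
     (\<alpha> - \<beta>) * (real k + 1) * coeff (P n) (k + 1) - (real k + 2) * (real k + 1) * coeff (P n) (k + 2)"
  using arg_cong[OF jacobi_op_P[of n], of "\<lambda>p. coeff p k"]
  unfolding coeff_jacobi_op by (simp add: algebra_simps)

lemma coeff_P_1: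
  assumes "n \<ge> 1"
  shows "coeff (P n) (n - 1) = real n * (\<alpha> - \<beta>) / (2 * real n + \<alpha> + \<beta>)"
proof -
  have pos: "2 * real n + \<alpha> + \<beta> > 0" using assms alpha beta by simp
  show ?thesis
    using coeff_P_recurrence[of n "n - 1"] assms pos by (simp add: of_nat_diff field_simps)
qed

lemma coeff_P_2:
  assumes "n \<ge> 2"
  shows "coeff (P n) (n - 2) = real n * (real n - 1) * ((\<alpha> - \<beta>)\<^sup>2 - (2 * real n + \<alpha> + \<beta>))
    / (2 * (2 * real n + \<alpha> + \<beta>) * (2 * real n + \<alpha> + \<beta> - 1))"
proof -
  define t where "t = 2 * real n + \<alpha> + \<beta>"
  have pos: "t > 2" using assms alpha beta by (simp add: t_def)
  define u where "u = coeff (P n) (n - 1)"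
  have u: "t * u = real n * (\<alpha> - \<beta>)"
    using coeff_P_1[of n] assms pos by (simp add: u_def t_def)
  have "n - 2 + 1 = n - 1" "n - 2 + 2 = n" using assms by auto
  then have rec: "2 * (t - 1) * coeff (P n) (n - 2) =
      (\<alpha> - \<beta>) * (real n - 1) * u - real n * (real n - 1)"
    using coeff_P_recurrence[of n "n - 2"] assms
    by (simp add: of_nat_diff u_def t_def algebra_simps del: add_2_eq_Suc')
  have "2 * t * (t - 1) * coeff (P n) (n - 2) = t * (2 * (t - 1) * coeff (P n) (n - 2))"
    by simp
  also have "\<dots> = (\<alpha> - \<beta>) * (real n - 1) * (t * u) - t * (real n * (real n - 1))"
    unfolding rec by (simp add: algebra_simps)
  also have "\<dots> = real n * (real n - 1) * ((\<alpha> - \<beta>)\<^sup>2 - t)"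
    unfolding u by (simp add: algebra_simps power2_eq_square)
  finally show ?thesis
    using pos unfolding t_def[symmetric] by (simp add: field_simps)
qed

section \<open>The three-term recurrence and its coefficients\<close>

lemma gamma1_eq:
  assumes "n \<ge> 1"
  shows "gamma1 \<alpha> \<beta> n = coeff (P n) (n - 1) - coeff (P (Suc n)) n"
proof -
  define t where "t = 2 * real n + \<alpha> + \<beta>"
  have pos: "t > 0" using assms alpha beta by (simp add: t_def)
  \<comment> \<open>Eliminating n leaves an identity of rational functions in t, \<alpha> and
    \<beta>.\<close>
  have n: "real n = (t - \<alpha> - \<beta>) / 2" by (simp add: t_def)
  have "coeff (P n) (n - 1) = real n * (\<alpha> - \<beta>) / t"
    using coeff_P_1[OF assms] by (simp add: t_def)
  moreover have "coeff (P (Suc n)) n = (real n + 1) * (\<alpha> - \<beta>) / (t + 2)"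
    using coeff_P_1[of "Suc n"] by (simp add: t_def algebra_simps)
  moreover have "gamma1 \<alpha> \<beta> n = (\<beta>\<^sup>2 - \<alpha>\<^sup>2) / (t * (t + 2))"
    by (simp add: gamma1_def t_def)
  moreover have "t \<noteq> 0" "t + 2 \<noteq> 0" using pos by auto
  ultimately show ?thesis
    unfolding n by (simp add: divide_simps) algebra
qed

text \<open>\<open>pCons 0\<close> is multiplication by x; moved to the other factor it produces a
  monic polynomial of degree n.\<close>

lemma L_x_P_P: "n \<ge> 1 \<Longrightarrow> L (pCons 0 (P n) * P (n - 1)) = h n"
  using ip_P_monic[of "pCons 0 (P (n - 1))" n]
  by (simp add: coeff_pCons mult.commute split: nat.split)

lemma L_x_P_P_low: "Suc j < n \<Longrightarrow> L (pCons 0 (P n) * P j) = 0"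
  using ip_P[of n "pCons 0 (P j)"]
  by (simp add: coeff_pCons mult.commute split: nat.split)

text \<open>The defect \<open>R\<close> has degree below n, by \<open>gamma1_eq\<close> at x^n, and
  is orthogonal to the lower \<open>P j\<close>: since x can change factors, x P_n pairs
  nontrivially only with \<open>P (n - 1)\<close> among them.\<close>

lemma three_term:
  assumes "n \<ge> 1"
  shows "P (Suc n) = [:- gamma1 \<alpha> \<beta> n, 1:] * P n - smult (h n / h (n - 1)) (P (n - 1))"
proof -
  define R where "R = pCons 0 (P n) - P (Suc n) - smult (gamma1 \<alpha> \<beta> n) (P n)
    - smult (h n / h (n - 1)) (P (n - 1))"
  have "R = 0"
  proof (rule eq_0_if_orthogonal_to_P[where n = n])
    show "coeff R i = 0" if i: "n \<le> i" for i
    proof -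
      consider "i = n" | "i = Suc n" | "i > Suc n" using i by linarith
      then show ?thesis
        using assms by cases (auto simp: R_def coeff_pCons gamma1_eq split: nat.split)
    qed
    show "L (R * P j) = 0" if "j < n" for j
    proof (cases "j = n - 1")
      case True
      then show ?thesis
        using that ip_P_pos[of j] L_x_P_P[of n]
        by (simp add: R_def diff_left L_smult ip_P_P)
    next
      case False
      then show ?thesis
        using that L_x_P_P_low[of j n] by (simp add: R_def diff_left L_smult ip_P_P)
    qed
  qed
  then show ?thesis by (simp add: R_def algebra_simps)
qed

text \<open>The norm ratio is read off from the coefficient of x^(n-1) in the recurrence and
  compared with the closed formula.\<close>

lemma gamma2_eq:
  assumes "n \<ge> 1"
  shows "gamma2 \<alpha> \<beta> n = h n / h (n - 1)"
proof -
  define t where "t = 2 * real n + \<alpha> + \<beta>"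
  have pos: "t > 0" using assms alpha beta by (simp add: t_def)
  \<comment> \<open>In x P_n this coefficient is that of x^(n-2) in P_n. It is absent for n = 1,
    where natural subtraction would point to index 0.\<close>
  have rec: "h n / h (n - 1) =
      (if n = 1 then 0 else coeff (P n) (n - 2)) - coeff (P (Suc n)) (n - 1)
      - gamma1 \<alpha> \<beta> n * coeff (P n) (n - 1)"
    using arg_cong[OF three_term[OF assms], of "\<lambda>p. coeff p (n - 1)"] assms
    by (cases n; cases "n - 1") (auto simp: numeral_2_eq_2)
  have u: "coeff (P n) (n - 1) = real n * (\<alpha> - \<beta>) / t"
    using coeff_P_1[OF assms] by (simp add: t_def)
  have g: "gamma1 \<alpha> \<beta> n = (\<beta>\<^sup>2 - \<alpha>\<^sup>2) / (t * (t + 2))"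
    by (simp add: gamma1_def t_def)
  have v': "coeff (P (Suc n)) (n - 1) =
      (real n + 1) * real n * ((\<alpha> - \<beta>)\<^sup>2 - (t + 2)) / (2 * (t + 2) * (t + 1))"
    using coeff_P_2[of "Suc n"] assms by (simp add: t_def algebra_simps)
  show ?thesis
  proof (cases "n = 1")
    case True
    have t: "\<alpha> = t - 2 - \<beta>" using True by (simp add: t_def)
    have "t \<noteq> 0" "t + 1 \<noteq> 0" "t + 2 \<noteq> 0" using pos by auto
    moreover have g2: "gamma2 \<alpha> \<beta> n = 4 * (1 + \<alpha>) * (1 + \<beta>) / (t\<^sup>2 * (t + 1))"
      using True by (simp add: gamma2_def t_def algebra_simps)
    ultimately show ?thesis
      unfolding rec u g v' g2 using True unfolding t
      by (simp add: divide_simps) (simp add: algebra_simps power2_eq_square)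
  next
    case False
    \<comment> \<open>Now t > 2, so the factor t - 1 of the general formula is nonzero; for n = 1 it
      may vanish and stands cancelled.\<close>
    then have "n \<ge> 2" using assms by simp
    then have "t > 2" using alpha beta by (simp add: t_def)
    then have nz: "t \<noteq> 0" "t + 1 \<noteq> 0" "t + 2 \<noteq> 0" "t - 1 \<noteq> 0" by auto
    have n: "real n = (t - \<alpha> - \<beta>) / 2" by (simp add: t_def)
    have v: "coeff (P n) (n - 2) = real n * (real n - 1) * ((\<alpha> - \<beta>)\<^sup>2 - t) / (2 * t * (t - 1))"
      using coeff_P_2[OF \<open>n \<ge> 2\<close>] by (simp add: t_def)
    have g2: "gamma2 \<alpha> \<beta> n = 4 * real n * (real n + \<alpha>) * (real n + \<beta>) * (real n + \<alpha> + \<beta>)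
        / (t\<^sup>2 * ((t - 1) * (t + 1)))"
      using False by (simp add: gamma2_def t_def algebra_simps power2_eq_square)
    have "gamma2 \<alpha> \<beta> n = coeff (P n) (n - 2) - coeff (P (Suc n)) (n - 1)
        - gamma1 \<alpha> \<beta> n * coeff (P n) (n - 1)"
      unfolding u g v v' g2 n using nz
      by (simp add: divide_simps) (simp add: algebra_simps power2_eq_square)
    with False show ?thesis unfolding rec by simp
  qed
qed

lemma gamma2_pos: "n \<ge> 1 \<Longrightarrow> gamma2 \<alpha> \<beta> n > 0"
  by (simp add: gamma2_eq ip_P_pos)

section \<open>Structure relations for the derivatives of Jacobi polynomials\<close>

lemma b_hat_eq:
  assumes "n \<ge> 1"
  shows "b_hat \<alpha> \<beta> n = (2 * real n + \<alpha> + \<beta> + 1) * gamma2 \<alpha> \<beta> n"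
proof (cases "n = 1")
  case True
  have "3 + \<alpha> + \<beta> \<noteq> 0" "2 + \<alpha> + \<beta> \<noteq> 0" using alpha beta by auto
  with True show ?thesis by (simp add: b_hat_def gamma2_def divide_simps)
next
  case False
  define t where "t = 2 * real n + \<alpha> + \<beta>"
  have "n \<ge> 2" using False assms by simp
  then have "t > 2" using alpha beta by (simp add: t_def)
  then have "t + 1 \<noteq> 0" "t - 1 \<noteq> 0" "t \<noteq> 0" by auto
  moreover have "t\<^sup>2 - 1 = (t - 1) * (t + 1)" by (simp add: algebra_simps power2_eq_square)
  ultimately show ?thesis
    using False unfolding b_hat_def gamma2_def t_def[symmetric] by (simp add: divide_simps)
qed

lemma a_hat_eq:
  assumes "n \<ge> 1"
  shows "a_hat \<alpha> \<beta> n = [:coeff (P n) (n - 1), - real n:]"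
proof -
  have "2 * real n + \<alpha> + \<beta> > 0" using assms alpha beta by simp
  then show ?thesis
    using coeff_P_1[OF assms] by (simp add: a_hat_def field_simps)
qed

text \<open>Integration by parts shows that (1 - x^2) P_n' involves only P_(n+1), P_n and P_(n-1);
  the recurrence then removes P_(n+1).\<close>

lemma structure_relation:
  assumes "n \<ge> 1"
  shows "one_minus_x2 * pderiv (P n) = a_hat \<alpha> \<beta> n * P n + smult (b_hat \<alpha> \<beta> n) (P (n - 1))"
proof -
  \<comment> \<open>\<open>e\<close> is forced by the coefficient of x^n and \<open>f\<close> by the
    product with \<open>P (n - 1)\<close>; the factor -n of P_(n+1) comes from the leading
    terms.\<close>
  define e where "e = real n * coeff (P (Suc n)) n - (real n - 1) * coeff (P n) (n - 1)"
  define f where "f = (real n + \<alpha> + \<beta> + 1) * (h n / h (n - 1))"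
  define R where "R = one_minus_x2 * pderiv (P n) + smult (real n) (P (Suc n)) - smult e (P n)
    - smult f (P (n - 1))"
  have inner: "L (one_minus_x2 * pderiv (P n) * g) =
      L (P n * ([:\<alpha> - \<beta>, \<alpha> + \<beta> + 2:] * g - one_minus_x2 * pderiv g))" for g
  proof -
    have "one_minus_x2 * pderiv (P n) * g =
        one_minus_x2 * pderiv (P n * g) - P n * (one_minus_x2 * pderiv g)"
      unfolding pderiv_mult by (simp only: algebra_simps)
    then have "L (one_minus_x2 * pderiv (P n) * g) =
        L ([:\<alpha> - \<beta>, \<alpha> + \<beta> + 2:] * (P n * g)) - L (P n * (one_minus_x2 * pderiv g))"
      by (simp only: L_diff pearson)
    also have "[:\<alpha> - \<beta>, \<alpha> + \<beta> + 2:] * (P n * g) = P n * ([:\<alpha> - \<beta>, \<alpha> + \<beta> + 2:] * g)"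
      by (simp only: mult.left_commute)
    finally show ?thesis
      by (simp only: right_diff_distrib L_diff)
  qed
  \<comment> \<open>The transposed operator raises the degree by at most one, with leading factor i
    + \<alpha> + \<beta> + 2. So among the lower \<open>P j\<close> only \<open>P (n - 1)\<close>
    can have a nonzero product.\<close>
  have coeff_inner: "coeff ([:\<alpha> - \<beta>, \<alpha> + \<beta> + 2:] * g - one_minus_x2 * pderiv g) (Suc i) =
      (real i + \<alpha> + \<beta> + 2) * coeff g i + (\<alpha> - \<beta>) * coeff g (Suc i) - (real i + 2) * coeff g (i + 2)"
    for g i
    by (auto simp: coeff_pderiv coeff_pCons algebra_simps split: nat.split)
  have "R = 0"
  proof (rule eq_0_if_orthogonal_to_P[where n = n])
    show "coeff R i = 0" if i: "n \<le> i" for i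
    proof -
      obtain m where m: "n = Suc m" using assms by (cases n) auto
      consider "i = n" | "i = Suc n" | "i > Suc n" using i by linarith
      then show ?thesis
      proof cases
        case 1
        then show ?thesis
          by (cases m) (simp_all add: R_def coeff_pCons coeff_pderiv e_def m)
      next
        case 2
        then show ?thesis
          by (simp add: R_def coeff_pCons coeff_pderiv m)
      next
        case 3
        then obtain k where "i = Suc (Suc k)" "n < Suc k" by (cases i; cases "i - 1") auto
        then show ?thesis
          by (simp add: R_def coeff_pCons coeff_pderiv)
      qed
    qed
    show "L (R * P j) = 0" if j: "j < n" for j
    proof -
      define Y where "Y = [:\<alpha> - \<beta>, \<alpha> + \<beta> + 2:] * P j - one_minus_x2 * pderiv (P j)"
      have Y: "coeff Y (Suc i) =
          (real i + \<alpha> + \<beta> + 2) * coeff (P j) i + (\<alpha> - \<beta>) * coeff (P j) (Suc i)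
          - (real i + 2) * coeff (P j) (i + 2)" for i
        unfolding Y_def by (rule coeff_inner)
      have LY: "L (one_minus_x2 * pderiv (P n) * P j) = L (Y * P n)"
        using inner[of "P j"] commute[of Y "P n"] by (simp only: Y_def)
      show ?thesis
      proof (cases "j = n - 1")
        case True
        define r where "r = real j + \<alpha> + \<beta> + 2"
        have n: "n = Suc j" using True that by simp
        have "L ((Y - smult r (P n)) * P n) = 0"
        proof (rule ip_P)
          fix i assume "n \<le> i"
          then obtain k where k: "i = Suc k" "j \<le> k" using n by (cases i) auto
          then show "coeff (Y - smult r (P n)) i = 0"
            by (cases "k = j") (simp_all add: Y r_def n)
        qed
        then have "L (Y * P n) = r * h n" by (simp add: diff_left L_smult)
        moreover have "f * h j = r * h n"
          using ip_P_pos[of j] by (simp add: f_def n r_def)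
        ultimately show ?thesis
          using LY unfolding R_def by (simp add: n add_left diff_left L_smult ip_P_P)
      next
        case False
        have "L (Y * P n) = 0"
        proof (rule ip_P)
          fix i assume "n \<le> i"
          then obtain k where k: "i = Suc k" "j < k" using False j by (cases i) auto
          then show "coeff Y i = 0" by (simp add: Y)
        qed
        with False that LY show ?thesis
          by (simp add: R_def add_left diff_left L_smult ip_P_P)
      qed
    qed
  qed
  then have "one_minus_x2 * pderiv (P n) =
      smult e (P n) + smult f (P (n - 1)) - smult (real n) (P (Suc n))"
    by (simp add: R_def algebra_simps)
  also have "\<dots> = smult e (P n) + smult f (P (n - 1))
      - smult (real n) ([:- gamma1 \<alpha> \<beta> n, 1:] * P n - smult (h n / h (n - 1)) (P (n - 1)))"
    by (subst three_term[OF assms]) (rule refl)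
  also have "\<dots> = (smult e (P n) - smult (real n) ([:- gamma1 \<alpha> \<beta> n, 1:] * P n))
      + smult (f + real n * (h n / h (n - 1))) (P (n - 1))"
    by (simp add: smult_diff_right smult_add_right smult_add_left algebra_simps)
  also have "f + real n * (h n / h (n - 1)) = b_hat \<alpha> \<beta> n"
    unfolding f_def b_hat_eq[OF assms] gamma2_eq[OF assms] by algebra
  also have "smult e (P n) - smult (real n) ([:- gamma1 \<alpha> \<beta> n, 1:] * P n) =
      [:e + real n * gamma1 \<alpha> \<beta> n, - real n:] * P n"
    by (simp add: smult_add_left smult_diff_right algebra_simps)
  also have "e + real n * gamma1 \<alpha> \<beta> n = coeff (P n) (n - 1)"
    by (simp add: e_def gamma1_eq[OF assms] algebra_simps)
  finally show ?thesis by (simp only: a_hat_eq[OF assms])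
qed

text \<open>The structure relation at m = n - 1, with P_(m-1) expressed by P_m and P_(m+1) through
  the recurrence.\<close>

lemma structure_relation_lower:
  assumes "n \<ge> 1"
  shows "one_minus_x2 * pderiv (P (n - 1)) = c_hat \<alpha> \<beta> n * P (n - 1) + smult (d_hat \<alpha> \<beta> n) (P n)"
\<comment> \<open>For n = 1 the recurrence has no lower polynomial to eliminate. The left-hand side
  is 0, and the right-hand terms cancel because \<open>c_hat\<close> is a multiple of
  \<open>P 1\<close>.\<close>
proof (cases "n = 1")
  case True
  obtain u where P1: "P 1 = [:u, 1:]"
    using P_1 by auto
  have "u = (\<alpha> - \<beta>) / (2 + \<alpha> + \<beta>)"
    using coeff_P_1[of 1] P1 by simp
  moreover have "2 + \<alpha> + \<beta> > 0" using alpha beta by simp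
  ultimately have "c_hat \<alpha> \<beta> 1 = smult (1 + \<alpha> + \<beta>) (P 1)"
    unfolding P1 c_hat_def by simp
  with True show ?thesis
    by (simp add: P_0 d_hat_def smult_add_left[symmetric])
next
  case False
  define m where "m = n - 1"
  have m: "m \<ge> 1" "n = Suc m" using assms False by (auto simp: m_def)
  define t where "t = 2 * real m + \<alpha> + \<beta>"
  have t: "t > 0" using m alpha beta by (simp add: t_def)
  define g where "g = gamma2 \<alpha> \<beta> m"
  have "smult g (P (m - 1)) = [:- gamma1 \<alpha> \<beta> m, 1:] * P m - P (Suc m)"
    using three_term[OF m(1)] gamma2_eq[OF m(1)] by (simp add: g_def)
  moreover have "one_minus_x2 * pderiv (P m) = a_hat \<alpha> \<beta> m * P m + smult (t + 1) (smult g (P (m - 1)))"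
    using structure_relation[OF m(1)] b_hat_eq[OF m(1)] by (simp add: g_def t_def)
  ultimately have "one_minus_x2 * pderiv (P m) =
      a_hat \<alpha> \<beta> m * P m + smult (t + 1) ([:- gamma1 \<alpha> \<beta> m, 1:] * P m - P (Suc m))"
    by (simp only:)
  then have "one_minus_x2 * pderiv (P m) =
      (a_hat \<alpha> \<beta> m + smult (t + 1) [:- gamma1 \<alpha> \<beta> m, 1:]) * P m + smult (- (t + 1)) (P (Suc m))"
    by (simp only: smult_diff_right smult_add_right smult_minus_right distrib_right mult_smult_left smult_minus_left diff_conv_add_uminus add.assoc)
  moreover have "a_hat \<alpha> \<beta> m + smult (t + 1) [:- gamma1 \<alpha> \<beta> m, 1:] = c_hat \<alpha> \<beta> n"
  proof -
    have u: "coeff (P m) (m - 1) = real m * (\<alpha> - \<beta>) / t"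
      using coeff_P_1[OF m(1)] by (simp add: t_def)
    have ge: "gamma1 \<alpha> \<beta> m = (\<beta>\<^sup>2 - \<alpha>\<^sup>2) / (t * (t + 2))"
      by (simp add: gamma1_def t_def)
    have rm: "real m = (t - \<alpha> - \<beta>) / 2" by (simp add: t_def)
    have nz: "t \<noteq> 0" "t + 2 \<noteq> 0" using t by auto
    have ch: "c_hat \<alpha> \<beta> n = smult ((real m + 1 + \<alpha> + \<beta>) / (t + 2)) [:\<alpha> - \<beta>, t + 2:]"
      by (simp add: c_hat_def m t_def algebra_simps)
    have "real m * (\<alpha> - \<beta>) / t - (t + 1) * ((\<beta>\<^sup>2 - \<alpha>\<^sup>2) / (t * (t + 2))) =
        (real m + 1 + \<alpha> + \<beta>) / (t + 2) * (\<alpha> - \<beta>)"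
      unfolding rm using nz by (simp add: divide_simps) algebra
    moreover have "t + 1 - real m = real m + 1 + \<alpha> + \<beta>"
      by (simp add: t_def)
    ultimately show ?thesis
      unfolding a_hat_eq[OF m(1)] ch u ge using nz by simp
  qed
  moreover have "- (t + 1) = d_hat \<alpha> \<beta> n"
    by (simp add: m t_def d_hat_def)
  ultimately have "one_minus_x2 * pderiv (P m) = c_hat \<alpha> \<beta> n * P m + smult (d_hat \<alpha> \<beta> n) (P (Suc m))"
    by (simp only:)
  with m show ?thesis by simp
qed

end

subsection \<open>The Jacobi weight\<close>

definition jacobi_weight :: "real \<Rightarrow> real \<Rightarrow> real \<Rightarrow> real" where
  "jacobi_weight \<alpha> \<beta> x = indicator {-1..1} x * ((1 - x) powr \<alpha> * (1 + x) powr \<beta>)"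

lemma jacobi_weight_measurable [measurable]: "jacobi_weight \<alpha> \<beta> \<in> borel_measurable borel"
  unfolding jacobi_weight_def[abs_def] by measurable

lemma poly_real_measurable [measurable]: "poly (f :: real poly) \<in> borel_measurable borel"
  by (intro borel_measurable_continuous_onI continuous_intros)

lemma jacobi_weight_nonneg: "jacobi_weight \<alpha> \<beta> x \<ge> 0"
  by (simp add: jacobi_weight_def indicator_def)

text \<open>The weight vanishes at the endpoints because \<open>0 powr a = 0\<close> for every exponent.\<close>

lemma jacobi_weight_eq_indicator_open:
  "jacobi_weight \<alpha> \<beta> x = indicator {-1<..<1} x * ((1 - x) powr \<alpha> * (1 + x) powr \<beta>)"
  by (auto simp: jacobi_weight_def indicator_def)

text \<open>The substitution t = (1 + x) / 2 turns the Beta integrand into the weight, up to the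
  factor 2 powr (\<alpha> + \<beta>).\<close>

lemma integrable_jacobi_weight:
  assumes "\<alpha> > -1" "\<beta> > -1"
  shows "integrable lborel (jacobi_weight \<alpha> \<beta>)"
proof -
  have "integrable lborel (\<lambda>t. indicator {0..1} t *\<^sub>R (t powr \<beta> * (1 - t) powr \<alpha>))"
    using integrable_Beta[of "\<beta> + 1" "\<alpha> + 1"] assms by (simp add: set_integrable_def)
  from lborel_integrable_real_affine[OF this, of "1/2" "1/2"]
  have "integrable lborel (\<lambda>x. 2 powr (\<alpha> + \<beta>) * (indicator {0..1} (1/2 + 1/2 * x) *\<^sub>R
      ((1/2 + 1/2 * x) powr \<beta> * (1 - (1/2 + 1/2 * x)) powr \<alpha>)))"
    by (intro integrable_mult_right) simp
  also have "(\<lambda>x. 2 powr (\<alpha> + \<beta>) * (indicator {0..1} (1/2 + 1/2 * x) *\<^sub>R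
      ((1/2 + 1/2 * x) powr \<beta> * (1 - (1/2 + 1/2 * x)) powr \<alpha>))) = jacobi_weight \<alpha> \<beta>"
  proof
    fix x :: real
    show "2 powr (\<alpha> + \<beta>) * (indicator {0..1} (1/2 + 1/2 * x) *\<^sub>R
      ((1/2 + 1/2 * x) powr \<beta> * (1 - (1/2 + 1/2 * x)) powr \<alpha>)) = jacobi_weight \<alpha> \<beta> x"
    proof (cases "x \<in> {-1..1}")
      case True
      then have "(1/2 + 1/2 * x) powr \<beta> = (1 + x) powr \<beta> / 2 powr \<beta>"
        using powr_divide[of "1 + x" 2 \<beta>] by (simp add: add_divide_distrib)
      moreover have "(1 - (1/2 + 1/2 * x)) powr \<alpha> = (1 - x) powr \<alpha> / 2 powr \<alpha>"
        using powr_divide[of "1 - x" 2 \<alpha>] True by (simp add: diff_divide_distrib)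
      ultimately show ?thesis
        using True by (simp add: jacobi_weight_def powr_add)
    next
      case False
      then show ?thesis by (auto simp: jacobi_weight_def indicator_def)
    qed
  qed
  finally show ?thesis .
qed

text \<open>The polynomial is bounded on [-1, 1] and the weight vanishes outside, so a multiple of
  the weight dominates.\<close>

lemma integrable_jacobi_weight_poly:
  assumes "\<alpha> > -1" "\<beta> > -1"
  shows "integrable lborel (\<lambda>x. jacobi_weight \<alpha> \<beta> x * poly f x)"
proof -
  have "compact (poly f ` {-1..1})"
    by (intro compact_continuous_image continuous_intros) auto
  then obtain B where B: "\<And>x. x \<in> {-1..1} \<Longrightarrow> \<bar>poly f x\<bar> \<le> B"
    by (metis compact_imp_bounded bounded_real imageI)
  show ?thesis
  proof (rule Bochner_Integration.integrable_bound)
    show "integrable lborel (\<lambda>x. B * jacobi_weight \<alpha> \<beta> x)"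
      using integrable_jacobi_weight[OF assms] by simp
    show "AE x in lborel. norm (jacobi_weight \<alpha> \<beta> x * poly f x) \<le> norm (B * jacobi_weight \<alpha> \<beta> x)"
    proof (rule AE_I2)
      fix x
      show "norm (jacobi_weight \<alpha> \<beta> x * poly f x) \<le> norm (B * jacobi_weight \<alpha> \<beta> x)"
      proof (cases "x \<in> {-1..1}")
        case True
        then have "\<bar>poly f x\<bar> \<le> \<bar>B\<bar>" using B[of x] by linarith
        then show ?thesis by (simp add: abs_mult mult.commute mult_right_mono)
      next
        case False
        then show ?thesis by (simp add: jacobi_weight_def)
      qed
    qed
  qed measurable
qed

definition jacobi_integral :: "real \<Rightarrow> real \<Rightarrow> real poly \<Rightarrow> real" where
  "jacobi_integral \<alpha> \<beta> f = (\<integral>x. jacobi_weight \<alpha> \<beta> x * poly f x \<partial>lborel)"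

lemma jacobi_inner_eq: "jacobi_inner \<alpha> \<beta> f g = jacobi_integral \<alpha> \<beta> (f * g)"
proof -
  have "jacobi_measure \<alpha> \<beta> = density lborel (\<lambda>x. ennreal (jacobi_weight \<alpha> \<beta> x))"
    by (simp add: jacobi_measure_def jacobi_weight_def)
  then show ?thesis
    by (simp add: jacobi_inner_def jacobi_integral_def integral_density jacobi_weight_nonneg)
qed

text \<open>If the integral were 0, the integrand would vanish almost everywhere. The weight is
  positive on the open interval and \<open>f\<close> has finitely many roots, so that interval would
  be null.\<close>

lemma jacobi_integral_square_pos:
  assumes "\<alpha> > -1" "\<beta> > -1" "f \<noteq> 0"
  shows "jacobi_integral \<alpha> \<beta> (f * f) > 0"
proof -
  have nonneg: "jacobi_weight \<alpha> \<beta> x * poly (f * f) x \<ge> 0" for x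
    by (simp add: jacobi_weight_nonneg)
  then have "jacobi_integral \<alpha> \<beta> (f * f) \<ge> 0"
    unfolding jacobi_integral_def by (intro integral_nonneg_AE) simp
  moreover have "jacobi_integral \<alpha> \<beta> (f * f) \<noteq> 0"
  proof
    assume "jacobi_integral \<alpha> \<beta> (f * f) = 0"
    then have "AE x in lborel. jacobi_weight \<alpha> \<beta> x * poly (f * f) x = 0"
      using integral_nonneg_eq_0_iff_AE[OF integrable_jacobi_weight_poly[OF assms(1,2), of "f * f"]] nonneg
      by (simp add: jacobi_integral_def)
    moreover have "AE x in lborel. x \<notin> {x. poly f x = 0}"
      using poly_roots_finite[OF \<open>f \<noteq> 0\<close>]
      by (intro AE_not_in countable_imp_null_set_lborel countable_finite)
    ultimately have "AE x in lborel. x \<notin> {-1<..<1::real}"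
      by eventually_elim (auto simp: jacobi_weight_eq_indicator_open)
    then have "emeasure lborel {-1<..<1::real} = 0"
      by (subst (asm) AE_iff_measurable[where N = "{-1<..<1}"]) auto
    then show False by simp
  qed
  ultimately show ?thesis by simp
qed

lemma jacobi_integral_add:
  assumes "\<alpha> > -1" "\<beta> > -1"
  shows "jacobi_integral \<alpha> \<beta> (f + g) = jacobi_integral \<alpha> \<beta> f + jacobi_integral \<alpha> \<beta> g"
  using integrable_jacobi_weight_poly[OF assms] by (simp add: jacobi_integral_def distrib_left)

lemma jacobi_integral_smult: "jacobi_integral \<alpha> \<beta> (smult a f) = a * jacobi_integral \<alpha> \<beta> f"
  by (simp add: jacobi_integral_def mult.left_commute)

lemma jacobi_integral_pearson:
  assumes "\<alpha> > -1" "\<beta> > -1"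
  shows "jacobi_integral \<alpha> \<beta> (one_minus_x2 * pderiv f) =
    jacobi_integral \<alpha> \<beta> ([:\<alpha> - \<beta>, \<alpha> + \<beta> + 2:] * f)"
proof -
  \<comment> \<open>\<open>F\<close> is (1 - x^2) w f and \<open>g\<close> is chosen so that F' = w
    g. The exponents \<alpha> + 1 and \<beta> + 1 are positive, so \<open>F\<close> tends to 0 at
    both endpoints and w g integrates to 0.\<close>
  define g where "g = one_minus_x2 * pderiv f - [:\<alpha> - \<beta>, \<alpha> + \<beta> + 2:] * f"
  define F where "F x = (1 - x) powr (\<alpha> + 1) * (1 + x) powr (\<beta> + 1) * poly f x" for x
  define F' where "F' x = (1 - x) powr \<alpha> * (1 + x) powr \<beta> * poly g x" for x
  have weight: "indicator {-1<..<1} x * F' x = jacobi_weight \<alpha> \<beta> x * poly g x" for x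
    by (simp add: F'_def jacobi_weight_eq_indicator_open)
  have cont: "continuous_on {-1..1} F"
    unfolding F_def using assms by (intro continuous_intros continuous_on_powr') auto
  have "(LBINT x=-1..1. F' x) = 0 - 0"
  proof (rule interval_integral_FTC_integrable[where F = F])
    fix x :: real assume "-1 < ereal x" "ereal x < 1"
    then have x: "-1 < x" "x < 1" by (simp_all add: one_ereal_def)
    show "isCont F' x"
      unfolding F'_def using x by (intro continuous_intros) auto
    have pw: "(1 - x) powr (\<alpha> + 1) = (1 - x) * (1 - x) powr \<alpha>"
      "(1 + x) powr (\<beta> + 1) = (1 + x) * (1 + x) powr \<beta>"
      using x by (simp_all add: powr_add)
    have "(F has_field_derivative
        (- ((\<alpha> + 1) * (1 - x) powr \<alpha>) * (1 + x) powr (\<beta> + 1)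
         + (1 - x) powr (\<alpha> + 1) * ((\<beta> + 1) * (1 + x) powr \<beta>)) * poly f x
        + (1 - x) powr (\<alpha> + 1) * (1 + x) powr (\<beta> + 1) * poly (pderiv f) x) (at x)"
      unfolding F_def using x by (auto intro!: derivative_eq_intros)
    also have "(- ((\<alpha> + 1) * (1 - x) powr \<alpha>) * (1 + x) powr (\<beta> + 1)
         + (1 - x) powr (\<alpha> + 1) * ((\<beta> + 1) * (1 + x) powr \<beta>)) * poly f x
        + (1 - x) powr (\<alpha> + 1) * (1 + x) powr (\<beta> + 1) * poly (pderiv f) x = F' x"
      unfolding pw F'_def g_def by (simp add: algebra_simps)
    finally show "(F has_vector_derivative F' x) (at x)"
      by (simp add: has_real_derivative_iff_has_vector_derivative)
  next
    show "set_integrable lborel (einterval (-1) 1) F'"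
      using integrable_jacobi_weight_poly[OF assms, of g]
      by (simp add: set_integrable_def weight one_ereal_def)
    have "(F \<longlongrightarrow> F (-1)) (at_right (-1))" "(F \<longlongrightarrow> F 1) (at_left 1)"
      using cont by (auto simp: continuous_on_Icc_at_rightD continuous_on_Icc_at_leftD)
    then show "((F \<circ> real_of_ereal) \<longlongrightarrow> 0) (at_right (-1))"
      "((F \<circ> real_of_ereal) \<longlongrightarrow> 0) (at_left 1)"
      by (simp_all add: ereal_tendsto_simps one_ereal_def F_def)
  qed (simp add: one_ereal_def)
  then have "jacobi_integral \<alpha> \<beta> g = 0"
    by (simp add: interval_lebesgue_integral_def set_lebesgue_integral_def weight one_ereal_def
        jacobi_integral_def)
  then show ?thesis
    using jacobi_integral_add[OF assms, of g "[:\<alpha> - \<beta>, \<alpha> + \<beta> + 2:] * f"]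
    by (simp only: g_def diff_add_cancel add_0)
qed

lemma jacobi_functional:
  assumes "\<alpha> > -1" "\<beta> > -1"
  shows "jacobi_functional \<alpha> \<beta> (jacobi_integral \<alpha> \<beta>)"
  by (rule jacobi_functional.intro[OF assms jacobi_integral_add[OF assms] jacobi_integral_smult
        jacobi_integral_square_pos[OF assms] jacobi_integral_pearson[OF assms]])

subsection \<open>Taylor polynomials and differentiated Christoffel--Darboux kernels\<close>

text \<open>Leibniz' rule for x f: at most one derivative can fall on x.\<close>

lemma higher_pderiv_pCons_0:
  "(pderiv ^^ Suc k) (pCons 0 f) =
     pCons 0 ((pderiv ^^ Suc k) f) + smult (of_nat (Suc k)) ((pderiv ^^ k) (f :: 'a :: {comm_semiring_1, semiring_no_zero_divisors} poly))"
proof (induction k)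
  case 0
  then show ?case by (simp add: pderiv_pCons add.commute)
next
  case (Suc k)
  have "(pderiv ^^ Suc (Suc k)) (pCons 0 f) = pderiv ((pderiv ^^ Suc k) (pCons 0 f))" by simp
  then show ?case
    unfolding Suc by (simp add: pderiv_add pderiv_smult pderiv_pCons smult_add_left add_ac)
qed

lemma taylor_poly_Suc:
  "taylor_poly (Suc k) y f =
     taylor_poly k y f + smult (poly_deriv_at (Suc k) f y / fact (Suc k)) ([:- y, 1:] ^ Suc k)"
  unfolding taylor_poly_def by (rule sum.atMost_Suc)

text \<open>Since x = y + (x - y), multiplying the Taylor polynomial of f by x creates one term of
  order k + 1, which truncation removes.\<close>

lemma taylor_poly_pCons_0:
  "taylor_poly k y (pCons 0 f) =
     pCons 0 (taylor_poly k y f) - smult (poly_deriv_at k f y / fact k) ([:- y, 1:] ^ Suc k)"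
proof (induction k)
  case 0
  then show ?case by (simp add: taylor_poly_def)
next
  case (Suc k)
  let ?q = "[:- y, 1:]"
  define F where "F = poly_deriv_at (Suc k) f y / fact (Suc k)"
  have "poly_deriv_at (Suc k) (pCons 0 f) y / fact (Suc k) = y * F + poly_deriv_at k f y / fact k"
    unfolding higher_pderiv_pCons_0 F_def by (simp add: add_divide_distrib del: funpow.simps)
  then have "taylor_poly (Suc k) y (pCons 0 f) =
      pCons 0 (taylor_poly k y f) + smult (y * F) (?q ^ Suc k)"
    unfolding taylor_poly_Suc Suc by (simp add: smult_add_left del: power_Suc)
  also have "smult (y * F) (?q ^ Suc k) = pCons 0 (smult F (?q ^ Suc k)) - smult F (?q ^ Suc (Suc k))"
  proof -
    have "?q ^ Suc (Suc k) = pCons 0 (?q ^ Suc k) - smult y (?q ^ Suc k)"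
      by (subst power_Suc) (simp del: power_Suc)
    then show ?thesis by (simp add: smult_diff_right mult.commute del: power_Suc)
  qed
  also have "pCons 0 (taylor_poly k y f) + \<dots> =
      pCons 0 (taylor_poly (Suc k) y f) - smult F (?q ^ Suc (Suc k))"
    unfolding taylor_poly_Suc F_def by (simp del: power_Suc funpow.simps)
  finally show ?case unfolding F_def .
qed

lemma taylor_poly_add: "taylor_poly k y (f + g) = taylor_poly k y f + taylor_poly k y g"
  by (simp add: taylor_poly_def higher_pderiv_add add_divide_distrib smult_add_left sum.distrib)

lemma taylor_poly_smult: "taylor_poly k y (smult a f) = smult a (taylor_poly k y f)"
proof (induction k)
  case 0
  then show ?case by (simp add: taylor_poly_def)
next
  case (Suc k)
  then show ?case
    unfolding taylor_poly_Suc higher_pderiv_smult by (simp add: smult_add_right del: power_Suc funpow.simps)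
qed

lemma taylor_poly_diff: "taylor_poly k y (f - g) = taylor_poly k y f - taylor_poly k y g"
  using taylor_poly_add[of k y "f - g" g] by simp

lemma taylor_poly_1: "taylor_poly k y 1 = 1"
proof (induction k)
  case 0
  then show ?case by (simp add: taylor_poly_def)
next
  case (Suc k)
  have "(pderiv ^^ Suc k) 1 = (0 :: real poly)"
    by (simp add: funpow_swap1)
  then show ?case unfolding taylor_poly_Suc Suc by (simp del: funpow.simps)
qed

lemma degree_taylor_poly_le: "degree (taylor_poly k y f) \<le> k"
  unfolding taylor_poly_def
  by (intro degree_sum_le) (auto intro!: order.trans[OF degree_smult_le] simp: degree_power_eq)

lemma coeff_taylor_poly_top: "coeff (taylor_poly k y f) k = poly_deriv_at k f y / fact k"
proof (cases k)
  case 0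
  then show ?thesis by (simp add: taylor_poly_def)
next
  case (Suc m)
  have "coeff (taylor_poly m y f) (Suc m) = 0"
    using degree_taylor_poly_le[of m y f] by (intro coeff_eq_0) simp
  moreover have "coeff ([:- y, 1:] ^ Suc m) (Suc m) = 1"
    using lead_coeff_power[of "[:- y, 1:]" "Suc m"] by (simp add: degree_power_eq del: power_Suc)
  ultimately show ?thesis
    unfolding Suc taylor_poly_Suc by (simp del: power_Suc funpow.simps)
qed

context jacobi_functional
begin

text \<open>The sum is the k-th derivative in y of the Christoffel-Darboux kernel. Multiplied by (x
  - y)^(k+1) the formula needs no division, and induction along the recurrence applies.\<close>

lemma christoffel_darboux_deriv:
  "smult (fact k / h n) (taylor_poly k y (P n) * P (Suc n) - taylor_poly k y (P (Suc n)) * P n) =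
     [:- y, 1:] ^ Suc k * (\<Sum>i\<le>n. smult (poly_deriv_at k (P i) y / h i) (P i))"
proof -
  let ?T = "taylor_poly k y" and ?q = "[:- y, 1:] ^ Suc k"
  define W where "W n = ?T (P n) * P (Suc n) - ?T (P (Suc n)) * P n" for n
  have lin: "[:- c, 1:] * f = pCons 0 f - smult c f" for c and f :: "real poly"
    by simp
  have W_0: "W 0 = smult (1 / fact k) (smult (poly_deriv_at k (P 0) y) (?q * P 0))"
  proof -
    obtain u where "P (Suc 0) = [:u, 1:]" using P_1 by blast
    then have P1: "P (Suc 0) = pCons 0 1 + smult u 1" by (simp add: one_pCons)
    have "?T (P (Suc 0)) = pCons 0 1 - smult (poly_deriv_at k 1 y / fact k) ?q + smult u 1"
      unfolding P1 taylor_poly_add taylor_poly_smult taylor_poly_pCons_0 taylor_poly_1 by (rule refl)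
    then show ?thesis
      by (simp add: W_def P_0 taylor_poly_1 P1 del: power_Suc funpow.simps)
  qed
  \<comment> \<open>By antisymmetry the terms with x and with \<open>c\<close> cancel. What remains
    is \<open>W n\<close>, scaled, and the truncation term of \<open>taylor_poly_pCons_0\<close>,
    which is the new summand of the kernel.\<close>
  have W_Suc: "W (Suc n) = smult (h (Suc n) / h n) (W n)
      + smult (poly_deriv_at k (P (Suc n)) y / fact k) (?q * P (Suc n))" for n
  proof -
    define c where "c = gamma1 \<alpha> \<beta> (Suc n)"
    define e where "e = h (Suc n) / h n"
    have rec: "P (Suc (Suc n)) = pCons 0 (P (Suc n)) - smult c (P (Suc n)) - smult e (P n)"
      using three_term[of "Suc n"] by (simp add: c_def e_def lin)
    have Trec: "?T (P (Suc (Suc n))) = pCons 0 (?T (P (Suc n)))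
        - smult (poly_deriv_at k (P (Suc n)) y / fact k) ?q
        - smult c (?T (P (Suc n))) - smult e (?T (P n))"
      unfolding rec taylor_poly_diff taylor_poly_smult taylor_poly_pCons_0 by (rule refl)
    show ?thesis
      unfolding W_def Trec unfolding rec e_def[symmetric]
      by (simp add: algebra_simps smult_diff_right smult_add_right del: power_Suc funpow.simps)
  qed
  have "smult (fact k / h n) (W n) = ?q * (\<Sum>i\<le>n. smult (poly_deriv_at k (P i) y / h i) (P i))"
  proof (induction n)
    case 0
    show ?case by (simp add: W_0 del: power_Suc funpow.simps)
  next
    case (Suc n)
    have "h n \<noteq> 0" "h (Suc n) \<noteq> 0" using ip_P_pos[of n] ip_P_pos[of "Suc n"] by auto
    then have "smult (fact k / h (Suc n)) (W (Suc n)) = smult (fact k / h n) (W n)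
        + ?q * smult (poly_deriv_at k (P (Suc n)) y / h (Suc n)) (P (Suc n))"
      unfolding W_Suc by (simp add: smult_add_right del: power_Suc funpow.simps)
    then show ?case unfolding Suc by (simp add: distrib_left del: power_Suc funpow.simps)
  qed
  then show ?thesis unfolding W_def .
qed

end

subsection \<open>Leading coefficients\<close>

text \<open>
  The value \<open>a\<close> may be \<open>0\<close>, so that cancellations need no case distinction.  Coefficients at
  index \<open>d - 1\<close>, where \<open>d = 0\<close> is possible, are expressed by applying the predicate at index \<open>d\<close>
  to \<open>pCons 0 f\<close>.
\<close>

definition top_coeff :: "real poly \<Rightarrow> nat \<Rightarrow> real \<Rightarrow> bool" where
  "top_coeff f m a \<longleftrightarrow> (\<forall>i>m. coeff f i = 0) \<and> coeff f m = a"

lemma top_coeff_add: "top_coeff f m a \<Longrightarrow> top_coeff g m b \<Longrightarrow> top_coeff (f + g) m (a + b)"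
  by (simp add: top_coeff_def)

lemma top_coeff_diff: "top_coeff f m a \<Longrightarrow> top_coeff g m b \<Longrightarrow> top_coeff (f - g) m (a - b)"
  by (simp add: top_coeff_def)

lemma top_coeff_minus: "top_coeff f m a \<Longrightarrow> top_coeff (- f) m (- a)"
  by (simp add: top_coeff_def)

lemma top_coeff_smult: "top_coeff f m a \<Longrightarrow> top_coeff (smult s f) m (s * a)"
  by (simp add: top_coeff_def)

lemma top_coeff_sum:
  "(\<And>i. i \<in> A \<Longrightarrow> top_coeff (f i) m (a i)) \<Longrightarrow> top_coeff (\<Sum>i\<in>A. f i) m (\<Sum>i\<in>A. a i)"
  by (simp add: top_coeff_def coeff_sum)

lemma top_coeff_Suc: "top_coeff f m a \<Longrightarrow> top_coeff f (Suc m) 0"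
  by (simp add: top_coeff_def)

lemma top_coeff_pCons_0_iff: "top_coeff (pCons 0 f) (Suc m) a \<longleftrightarrow> top_coeff f m a"
  unfolding top_coeff_def by (auto simp: coeff_pCons split: nat.splits)

lemma top_coeff_pCons_0_imp: "top_coeff (pCons 0 f) m a \<Longrightarrow> top_coeff f m 0"
  unfolding top_coeff_def by (metis coeff_pCons_Suc less_Suc_eq not_less_eq)

lemma top_coeff_iff_degree: "top_coeff f m a \<longleftrightarrow> degree f \<le> m \<and> coeff f m = a"
  unfolding top_coeff_def by (metis coeff_eq_0 degree_le order_le_less_trans)

lemma top_coeff_mult:
  assumes "top_coeff f m a" "top_coeff g n b"
  shows "top_coeff (f * g) (m + n) (a * b)"
proof -
  have deg: "degree f \<le> m" "degree g \<le> n" and ab: "coeff f m = a" "coeff g n = b"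
    using assms by (auto simp: top_coeff_iff_degree)
  have "coeff (f * g) (m + n) = a * b"
  proof (cases "degree f = m \<and> degree g = n")
    case True
    then show ?thesis using coeff_mult_degree_sum[of f g] ab by simp
  next
    case False
    then have "degree f < m \<or> degree g < n" using deg by auto
    moreover from this have "degree (f * g) < m + n"
      using degree_mult_le[of f g] deg by auto
    ultimately show ?thesis using ab by (auto simp: coeff_eq_0)
  qed
  then show ?thesis
    using degree_mult_le[of f g] deg by (simp add: top_coeff_iff_degree)
qed

text \<open>As \<open>a\<close> is nonzero, the product has degree exactly m + n, which fixes the
  degree of \<open>g\<close>.\<close>

lemma top_coeff_mult_cancel:
  assumes "top_coeff (f * g) (m + n) a" "top_coeff f m 1" "a \<noteq> 0"
  shows "top_coeff g n a"
proof -
  have "degree (f * g) = m + n"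
    using assms(1,3) le_degree[of "f * g" "m + n"] by (auto simp: top_coeff_iff_degree)
  moreover have f: "degree f = m"
    using assms(2) le_degree[of f m] by (auto simp: top_coeff_iff_degree)
  moreover have "f * g \<noteq> 0" using assms(1,3) by (auto simp: top_coeff_def)
  ultimately have "degree g = n" by (simp add: degree_mult_eq)
  then show ?thesis
    using assms(1,2) f coeff_mult_degree_sum[of f g] by (simp add: top_coeff_iff_degree)
qed

lemma top_coeff_imp_degree: "top_coeff f m a \<Longrightarrow> a \<noteq> 0 \<Longrightarrow> degree f = m \<and> f \<noteq> 0"
  using le_degree[of f m] by (auto simp: top_coeff_iff_degree)

lemma top_coeff_linear: "top_coeff [:b, a:] 1 a"
  by (simp add: top_coeff_def coeff_pCons split: nat.split)

lemma top_coeff_one_minus_x2_pderiv: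
  assumes "top_coeff f m a"
  shows "top_coeff (one_minus_x2 * pderiv f) (Suc m) (- (real m * a))"
  using assms unfolding top_coeff_def
  by (auto simp: coeff_pCons coeff_pderiv split: nat.splits)

text \<open>Here \<open>f\<close> has degree at most m - 1, hence the factor m - 1; for m = 0 both
  \<open>f\<close> and \<open>a\<close> vanish.\<close>

lemma top_coeff_one_minus_x2_pderiv':
  assumes "top_coeff (pCons 0 f) m a"
  shows "top_coeff (one_minus_x2 * pderiv f) m (- ((real m - 1) * a))"
proof (cases m)
  case 0
  then have "coeff f i = 0" for i
    using assms unfolding top_coeff_def by (metis coeff_pCons_Suc zero_less_Suc)
  then have "f = 0" by (simp add: poly_eq_iff)
  then show ?thesis using assms 0 by (simp add: top_coeff_def)
next
  case (Suc k)
  then show ?thesis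
    using top_coeff_one_minus_x2_pderiv[of f k a] assms by (simp add: top_coeff_pCons_0_iff)
qed

lemma top_coeff_mult_linear:
  assumes "top_coeff (pCons 0 f) m a"
  shows "top_coeff (f * smult s [:r, 1:]) m (s * a)"
proof -
  have "f * smult s [:r, 1:] = smult s (pCons 0 f + smult r f)"
    by (simp add: smult_add_right algebra_simps)
  moreover have "top_coeff (smult s (pCons 0 f + smult r f)) m (s * (a + r * 0))"
    by (intro top_coeff_smult top_coeff_add assms top_coeff_pCons_0_imp[OF assms])
  ultimately show ?thesis by simp
qed

lemma smult_sum_right: "smult a (\<Sum>i\<in>A. f i) = (\<Sum>i\<in>A. smult a (f i))"
  by (induction A rule: infinite_finite_induct) (simp_all add: smult_add_right)

lemma sum_pCons_0: "(\<Sum>i\<in>A. pCons 0 (f i)) = pCons 0 (\<Sum>i\<in>A. f i)"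
  by (induction A rule: infinite_finite_induct) simp_all

subsection \<open>Elimination\<close>

text \<open>Cramer's rule: p and q are recovered from s and t up to the determinant, and the factor
  \<open>\<rho>\<close> cancels. Primed letters are arbitrary ring elements, to be instantiated with
  derivatives or with the coefficients of index 3.\<close>

lemma ladder_relation:
  fixes a b c d :: "'a :: idom"
  assumes "\<rho> \<noteq> 0" "a * d - c * b = \<rho> * \<delta>"
    and "\<rho> * s = a * p + b * q" "\<rho> * t = c * p + d * q"
  shows "x * (\<rho>' * s + \<rho> * s') = a' * p + b' * q \<Longrightarrow>
      (x * \<rho>' * \<delta> + b' * c - a' * d) * s + x * (\<rho> * \<delta>) * s' = (b' * a - a' * b) * t"
    and "x * (\<rho>' * t + \<rho> * t') = c' * p + d' * q \<Longrightarrow>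
      (x * \<rho>' * \<delta> + c' * b - d' * a) * t + x * (\<rho> * \<delta>) * t' = (c' * d - d' * c) * s"
proof -
  have "\<rho> * (\<delta> * p) = \<rho> * (d * s - b * t)" "\<rho> * (\<delta> * q) = \<rho> * (a * t - c * s)"
    using assms(2-4) by algebra+
  then have pq: "\<delta> * p = d * s - b * t" "\<delta> * q = a * t - c * s"
    using assms(1) by simp_all
  show "(x * \<rho>' * \<delta> + b' * c - a' * d) * s + x * (\<rho> * \<delta>) * s' = (b' * a - a' * b) * t"
    if "x * (\<rho>' * s + \<rho> * s') = a' * p + b' * q"
    using that pq by algebra
  show "(x * \<rho>' * \<delta> + c' * b - d' * a) * t + x * (\<rho> * \<delta>) * t' = (c' * d - d' * c) * s"
    if "x * (\<rho>' * t + \<rho> * t') = c' * p + d' * q"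
    using that pq by algebra
qed

lemma Fract_ladder:
  fixes q :: "real poly"
  assumes "q \<noteq> 0" "a * s + b * s' = q * t"
  shows "Fract a q * to_fract s + Fract b q * to_fract s' = to_fract t"
proof -
  have "(a * s * q + b * s' * q) * 1 = t * (q * q)" using assms(2) by algebra
  then show ?thesis using assms(1) by (simp add: to_fract_def eq_fract)
qed

subsection \<open>Jacobi--Sobolev polynomials\<close>

locale jacobi_sobolev =
  fixes \<alpha> \<beta> :: real and N :: nat and ds :: "nat \<Rightarrow> nat"
    and c :: "nat \<Rightarrow> real" and lam :: "nat \<Rightarrow> nat \<Rightarrow> real"
  assumes alpha: "\<alpha> > -1" and beta: "\<beta> > -1"
begin

abbreviation "P \<equiv> jacobi_poly \<alpha> \<beta>"
abbreviation "h \<equiv> jacobi_h \<alpha> \<beta>"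
abbreviation "I \<equiv> I_plus N ds lam"
abbreviation "S \<equiv> sobolev_poly \<alpha> \<beta> N ds c lam"
abbreviation "ips \<equiv> sobolev_inner \<alpha> \<beta> N ds c lam"
abbreviation "H n \<equiv> ips (S n) (S n)"
abbreviation "\<rho> \<equiv> rho N ds c"
abbreviation "\<rho>q \<equiv> rho_quot N ds c"
abbreviation "dt \<equiv> d_total N ds"
abbreviation "A\<^sub>2 \<equiv> A2 \<alpha> \<beta> N ds c lam"
abbreviation "B\<^sub>2 \<equiv> B2 \<alpha> \<beta> N ds c lam"
abbreviation "A\<^sub>3 \<equiv> A3 \<alpha> \<beta> N ds c lam"
abbreviation "B\<^sub>3 \<equiv> B3 \<alpha> \<beta> N ds c lam"
abbreviation "C\<^sub>2 \<equiv> C2 \<alpha> \<beta> N ds c lam"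
abbreviation "C\<^sub>3 \<equiv> C3 \<alpha> \<beta> N ds c lam"
abbreviation "D\<^sub>2 \<equiv> D2 \<alpha> \<beta> N ds c lam"
abbreviation "D\<^sub>3 \<equiv> D3 \<alpha> \<beta> N ds c lam"
abbreviation "\<gamma>\<^sub>1 \<equiv> gamma1 \<alpha> \<beta>"
abbreviation "\<gamma>\<^sub>2 \<equiv> gamma2 \<alpha> \<beta>"
abbreviation "\<Delta> \<equiv> Delta \<alpha> \<beta> N ds c lam"
abbreviation "\<delta> \<equiv> delta \<alpha> \<beta> N ds c lam"
abbreviation "q\<^sub>0 \<equiv> q0 \<alpha> \<beta> N ds c lam"
abbreviation "q\<^sub>1 \<equiv> q1 \<alpha> \<beta> N ds c lam"
abbreviation "q\<^sub>2 \<equiv> q2 \<alpha> \<beta> N ds c lam"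
abbreviation "q\<^sub>3 \<equiv> q3 \<alpha> \<beta> N ds c lam"
abbreviation "q\<^sub>4 \<equiv> q4 \<alpha> \<beta> N ds c lam"

sublocale J: jacobi_functional \<alpha> \<beta> "jacobi_integral \<alpha> \<beta>"
  by (rule jacobi_functional[OF alpha beta])

text \<open>Identifies the polynomials of the abstract locale with \<open>jacobi_poly\<close>, so
  that its facts can be rewritten.\<close>

lemma J_P: "monic_orthogonal_poly (\<lambda>f g. jacobi_integral \<alpha> \<beta> (f * g)) = P"
  by (simp add: jacobi_poly_def jacobi_inner_eq[abs_def])

lemma h_eq: "jacobi_integral \<alpha> \<beta> (P n * P n) = h n"
  by (simp add: jacobi_h_def jacobi_inner_eq)

lemmas h_pos = J.ip_P_pos[unfolded J_P h_eq]
lemmas P_three_term = J.three_term[unfolded J_P h_eq]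
lemmas gamma2_eq_h = J.gamma2_eq[unfolded J_P h_eq]
lemmas P_structure = J.structure_relation[unfolded J_P h_eq]
lemmas P_structure_lower = J.structure_relation_lower[unfolded J_P h_eq]

section \<open>The Sobolev inner product and the Fourier expansion of S_n\<close>

lemma sobolev_inner_eq:
  "ips f g = jacobi_integral \<alpha> \<beta> (f * g) +
     (\<Sum>(j, k)\<in>I. lam j k * poly_deriv_at k f (c j) * poly_deriv_at k g (c j))"
  by (simp add: sobolev_inner_def jacobi_inner_eq)

sublocale Sob: poly_inner ips
proof
  show "ips (f + g) p = ips f p + ips g p" for f g p
    by (simp add: sobolev_inner_eq J.L_add higher_pderiv_add algebra_simps case_prod_unfold sum.distrib)
  show "ips (smult a f) g = a * ips f g" for a f g
    by (simp add: sobolev_inner_eq J.L_smult higher_pderiv_smult algebra_simps case_prod_unfold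
        sum_distrib_left)
  show "ips f g = ips g f" for f g
    by (simp add: sobolev_inner_eq ac_simps)
  \<comment> \<open>The Jacobi part is already positive, and the discrete part is a sum of squares
    with positive weights.\<close>
  show "ips f f > 0" if "f \<noteq> 0" for f
  proof -
    have "(\<Sum>(j, k)\<in>I. lam j k * poly_deriv_at k f (c j) * poly_deriv_at k f (c j)) \<ge> 0"
      by (intro sum_nonneg) (auto simp: I_plus_def mult.assoc)
    with J.L_pos[OF that] show ?thesis by (simp add: sobolev_inner_eq)
  qed
qed

lemma Sob_P: "monic_orthogonal_poly ips = S"
  by (simp add: sobolev_poly_def)

lemmas coeff_P_self = J.coeff_P_self[unfolded J_P]
lemmas coeff_P_high = J.coeff_P_high[unfolded J_P]
lemmas coeff_S_self = Sob.coeff_P_self[unfolded Sob_P]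
lemmas coeff_S_high = Sob.coeff_P_high[unfolded Sob_P]

lemma H_pos: "H n > 0"
  using Sob.ip_P_pos unfolding Sob_P .

definition mass :: "nat \<Rightarrow> nat \<times> nat \<Rightarrow> real" where
  "mass n = (\<lambda>(j, k). lam j k * poly_deriv_at k (S n) (c j))"

lemma sobolev_inner_S:
  "ips f (S n) = jacobi_integral \<alpha> \<beta> (S n * f) + (\<Sum>(j, k)\<in>I. mass n (j, k) * poly_deriv_at k f (c j))"
  by (simp add: sobolev_inner_eq mass_def ac_simps case_prod_unfold)

text \<open>\<open>P n\<close> and \<open>S n\<close> are both monic of degree n, so their product
  is \<open>H n\<close> in the Sobolev sense and \<open>h n\<close> in the Jacobi sense; the
  discrete part is the difference.\<close>

lemma mass_P_sum: "(\<Sum>(j, k)\<in>I. mass n (j, k) * poly_deriv_at k (P n) (c j)) = H n - h n"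
proof -
  have "ips (P n) (S n) = H n"
    by (rule Sob.ip_P_monic[unfolded Sob_P, OF coeff_P_self coeff_P_high])
  moreover have "jacobi_integral \<alpha> \<beta> (S n * P n) = h n"
    by (rule J.ip_P_monic[unfolded J_P h_eq, OF coeff_S_self coeff_S_high])
  ultimately show ?thesis using sobolev_inner_S[of "P n" n] by simp
qed

text \<open>\<open>S n - P n\<close> has degree below n and is expanded in the \<open>P i\<close>.
  Sobolev orthogonality converts each Jacobi coefficient into a sum over the masses, so the inner
  sums are differentiated kernels.\<close>

lemma S_fourier:
  "S n = P n - (\<Sum>(j, k)\<in>I. smult (mass n (j, k))
     (\<Sum>i<n. smult (poly_deriv_at k (P i) (c j) / h i) (P i)))"
proof -
  have coeff0: "jacobi_integral \<alpha> \<beta> ((S n - P n) * P i) =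
      - (\<Sum>(j, k)\<in>I. mass n (j, k) * poly_deriv_at k (P i) (c j))" if "i < n" for i
  proof -
    have "ips (P i) (S n) = 0"
      using Sob.ip_P[of n "P i", unfolded Sob_P] coeff_P_high that by simp
    moreover have "jacobi_integral \<alpha> \<beta> (P n * P i) = 0"
      using J.ip_P_P[of n i] that unfolding J_P by simp
    ultimately show ?thesis
      using sobolev_inner_S[of "P i" n] J.diff_left[of "S n" "P n" "P i"] by simp
  qed
  have "coeff (S n - P n) i = 0" if "n \<le> i" for i
  proof (cases "i = n")
    case True
    then show ?thesis by (simp add: coeff_P_self coeff_S_self)
  next
    case False
    then show ?thesis using that by (simp add: coeff_P_high coeff_S_high)
  qed
  then have "S n - P n = (\<Sum>i<n. smult (jacobi_integral \<alpha> \<beta> ((S n - P n) * P i) / h i) (P i))"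
    by (rule J.P_expansion[unfolded J_P h_eq])
  also have "\<dots> = (\<Sum>i<n. \<Sum>x\<in>I. - smult (mass n x)
      (smult (poly_deriv_at (snd x) (P i) (c (fst x)) / h i) (P i)))"
    by (rule sum.cong)
      (simp_all add: coeff0 case_prod_unfold sum_negf sum_divide_distrib smult_sum)
  also have "\<dots> = - (\<Sum>x\<in>I. \<Sum>i<n. smult (mass n x)
      (smult (poly_deriv_at (snd x) (P i) (c (fst x)) / h i) (P i)))"
    by (subst sum.swap) (simp add: sum_negf)
  also have "\<dots> = - (\<Sum>(j, k)\<in>I. smult (mass n (j, k))
     (\<Sum>i<n. smult (poly_deriv_at k (P i) (c j) / h i) (P i)))"
    by (simp only: smult_sum_right case_prod_unfold prod.collapse)
  finally show ?thesis by (simp add: algebra_simps)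
qed

section \<open>Connection formulas between Sobolev and Jacobi polynomials\<close>

lemma rho_quot_mult:
  assumes "(j, k) \<in> I"
  shows "\<rho>q j k * [:- c j, 1:] ^ Suc k = \<rho>"
proof -
  have j: "j \<in> {1..N}" "k \<le> ds j" using assms by (auto simp: I_plus_def)
  have "[:- c j, 1:] ^ (k + 1) dvd [:- c j, 1:] ^ (ds j + 1)"
    using j by (intro le_imp_power_dvd) simp
  also have "\<dots> dvd \<rho>"
    unfolding rho_def using j by (intro dvd_prodI) auto
  finally show ?thesis
    unfolding rho_quot_def by (simp only: dvd_div_mult_self Suc_eq_plus1)
qed

lemma lead_coeff_rho: "lead_coeff \<rho> = 1"
  unfolding rho_def lead_coeff_prod by (simp add: lead_coeff_power del: power_Suc)

lemma rho_neq_0: "\<rho> \<noteq> 0"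
  using lead_coeff_rho by force

lemma degree_rho: "degree \<rho> = dt"
  unfolding rho_def d_total_def
  by (subst degree_prod_eq_sum_degree) (auto simp: degree_power_eq simp del: power_Suc)

lemma top_coeff_rho: "top_coeff \<rho> dt 1"
  using lead_coeff_rho degree_rho by (auto simp: top_coeff_iff_degree)

text \<open>The monic quotient has degree d - k - 1 and the Taylor polynomial degree at most k, so
  the coefficient of x^(d-1) is the top Taylor coefficient.\<close>

lemma top_coeff_taylor_rho_quot:
  assumes "(j, k) \<in> I"
  shows "top_coeff (pCons 0 (taylor_poly k (c j) f * \<rho>q j k)) dt (poly_deriv_at k f (c j) / fact k)"
proof -
  let ?q = "[:- c j, 1:] ^ Suc k"
  have q: "top_coeff ?q (Suc k) 1"
    using lead_coeff_power[of "[:- c j, 1:]" "Suc k"]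
    by (simp add: top_coeff_iff_degree degree_power_eq del: power_Suc)
  have mult: "?q * \<rho>q j k = \<rho>"
    using rho_quot_mult[OF assms] by (simp only: mult.commute)
  then have "?q dvd \<rho>" by (metis dvd_triv_left)
  then have "Suc k \<le> dt"
    using dvd_imp_degree_le[of ?q \<rho>] rho_neq_0 degree_rho
    by (simp add: degree_power_eq del: power_Suc)
  then obtain e where e: "dt = Suc k + e" using le_Suc_ex by blast
  have "top_coeff (\<rho>q j k) e 1"
    using top_coeff_mult_cancel[of ?q "\<rho>q j k" "Suc k" e 1] q top_coeff_rho mult e by simp
  moreover have "top_coeff (taylor_poly k (c j) f) k (poly_deriv_at k f (c j) / fact k)"
    using degree_taylor_poly_le coeff_taylor_poly_top by (simp add: top_coeff_iff_degree)
  ultimately have "top_coeff (taylor_poly k (c j) f * \<rho>q j k) (k + e) (poly_deriv_at k f (c j) / fact k * 1)"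
    by (intro top_coeff_mult)
  then show ?thesis by (simp add: e top_coeff_pCons_0_iff)
qed

lemma connection:
  assumes "n \<ge> 1"
  shows "\<rho> * S n = A\<^sub>2 n * P n + B\<^sub>2 n * P (n - 1)"
proof -
  obtain m where n: "n = Suc m" using assms by (cases n) auto
  define X where "X x = smult (fact (snd x) * mass n x / h m)
    (taylor_poly (snd x) (c (fst x)) (P m) * \<rho>q (fst x) (snd x))" for x
  define Y where "Y x = smult (fact (snd x) * mass n x / h m)
    (taylor_poly (snd x) (c (fst x)) (P n) * \<rho>q (fst x) (snd x))" for x
  have A: "A\<^sub>2 n = \<rho> - (\<Sum>x\<in>I. X x)" and B: "B\<^sub>2 n = (\<Sum>x\<in>I. Y x)"
    by (simp_all add: A2_def B2_def X_def Y_def mass_def n case_prod_unfold mult.assoc)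
  \<comment> \<open>The factor (x - c_j)^(k+1) of \<open>\<rho>\<close> is what the
    Christoffel-Darboux formula at index n - 1 consumes; \<open>\<rho>q j k\<close> is left
    over.\<close>
  have term_eq: "\<rho> * smult (mass n x) (\<Sum>i<n. smult (poly_deriv_at (snd x) (P i) (c (fst x)) / h i) (P i))
      = X x * P n - Y x * P m" if "x \<in> I" for x
  proof -
    obtain j k where x: "x = (j, k)" by fastforce
    let ?q = "[:- c j, 1:] ^ Suc k"
    let ?s = "\<Sum>i<n. smult (poly_deriv_at k (P i) (c j) / h i) (P i)"
    have cd: "?q * ?s = smult (fact k / h m)
        (taylor_poly k (c j) (P m) * P n - taylor_poly k (c j) (P n) * P m)"
      using J.christoffel_darboux_deriv[of k m "c j"]
      unfolding J_P h_eq n lessThan_Suc_atMost by simp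
    have "\<rho> * smult (mass n x) ?s = smult (mass n x) (\<rho>q j k * (?q * ?s))"
      using rho_quot_mult[of j k] that
      by (simp only: x mult_smult_right mult.assoc[symmetric])
    also have "\<dots> = X x * P n - Y x * P m"
      unfolding cd by (simp add: X_def Y_def x smult_diff_right right_diff_distrib ac_simps)
    finally show ?thesis by (simp add: x)
  qed
  have "\<rho> * S n = \<rho> * P n - (\<Sum>x\<in>I. X x * P n - Y x * P m)"
    by (subst S_fourier)
      (simp add: right_diff_distrib sum_distrib_left case_prod_unfold term_eq del: mult_smult_right)
  also have "\<dots> = A\<^sub>2 n * P n + B\<^sub>2 n * P m"
    by (simp add: A B sum_subtractf sum_distrib_right left_diff_distrib)
  finally show ?thesis by (simp add: n)
qed

text \<open>The product rule applied to \<open>connection\<close>, with both derivatives on the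
  right replaced by the structure relations; collecting terms yields exactly \<open>A3\<close> and
  \<open>B3\<close>.\<close>

lemma connection_deriv:
  assumes "n \<ge> 1"
  shows "one_minus_x2 * (pderiv \<rho> * S n + \<rho> * pderiv (S n)) = A\<^sub>3 n * P n + B\<^sub>3 n * P (n - 1)"
proof -
  let ?A = "A\<^sub>2 n" and ?B = "B\<^sub>2 n" and ?p = "P n" and ?q = "P (n - 1)"
  have "one_minus_x2 * (pderiv \<rho> * S n + \<rho> * pderiv (S n)) = one_minus_x2 * pderiv (\<rho> * S n)"
    by (simp only: pderiv_mult ac_simps)
  also have "\<dots> = one_minus_x2 * pderiv ?A * ?p + ?A * (one_minus_x2 * pderiv ?p)
      + one_minus_x2 * pderiv ?B * ?q + ?B * (one_minus_x2 * pderiv ?q)"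
    unfolding connection[OF assms] pderiv_add pderiv_mult by (simp only: algebra_simps)
  also have "\<dots> = A\<^sub>3 n * ?p + B\<^sub>3 n * ?q"
  proof -
    have s: "smult r f = [:r:] * f" for r :: real and f by simp
    show ?thesis
      unfolding P_structure[OF assms] P_structure_lower[OF assms] A3_def B3_def s
      by (simp only: algebra_simps)
  qed
  finally show ?thesis .
qed

lemma gamma2_pos: "n \<ge> 1 \<Longrightarrow> \<gamma>\<^sub>2 n > 0"
  by (rule J.gamma2_pos)

text \<open>The recurrence solved for \<open>P (m - 1)\<close>. This explains the shape of
  \<open>C2\<close>, \<open>D2\<close>, \<open>C3\<close> and \<open>D3\<close>; A and B stay
  general to serve both index pairs.\<close>

lemma shift_index:
  assumes "m \<ge> 1"
  shows "- smult (1 / \<gamma>\<^sub>2 m) B * P (Suc m) + (A + B * smult (1 / \<gamma>\<^sub>2 m) [:- \<gamma>\<^sub>1 m, 1:]) * P m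
    = A * P m + B * P (m - 1)"
proof -
  have "smult (\<gamma>\<^sub>2 m) (P (m - 1)) = [:- \<gamma>\<^sub>1 m, 1:] * P m - P (Suc m)"
    using P_three_term[OF assms] gamma2_eq_h[OF assms] by simp
  then have "smult (1 / \<gamma>\<^sub>2 m) (smult (\<gamma>\<^sub>2 m) (P (m - 1))) = smult (1 / \<gamma>\<^sub>2 m) ([:- \<gamma>\<^sub>1 m, 1:] * P m - P (Suc m))"
    by (simp only:)
  then have low: "P (m - 1) = smult (1 / \<gamma>\<^sub>2 m) ([:- \<gamma>\<^sub>1 m, 1:] * P m - P (Suc m))"
    using gamma2_pos[OF assms] by simp
  have s: "smult r f = [:r:] * f" for r :: real and f by simp
  show ?thesis
    unfolding low s by algebra
qed

lemma connection_prev: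
  assumes "n \<ge> 2"
  shows "\<rho> * S (n - 1) = C\<^sub>2 n * P n + D\<^sub>2 n * P (n - 1)"
    and "one_minus_x2 * (pderiv \<rho> * S (n - 1) + \<rho> * pderiv (S (n - 1))) = C\<^sub>3 n * P n + D\<^sub>3 n * P (n - 1)"
  using shift_index[of "n - 1" "B\<^sub>2 (n - 1)" "A\<^sub>2 (n - 1)"]
    shift_index[of "n - 1" "B\<^sub>3 (n - 1)" "A\<^sub>3 (n - 1)"]
    connection[of "n - 1"] connection_deriv[of "n - 1"] assms
  by (simp_all only: C2_def C3_def D2_def D3_def) auto

text \<open>Consecutive orthogonal polynomials are coprime; descending along the recurrence avoids gcds.\<close>

lemma dvd_if_dvd_mult_P: "f dvd g * P (Suc n) \<Longrightarrow> f dvd g * P n \<Longrightarrow> f dvd g"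
proof (induction n)
  case 0
  then show ?case using J.P_0 unfolding J_P by simp
next
  case (Suc n)
  have "smult (\<gamma>\<^sub>2 (Suc n)) (g * P n) = [:- \<gamma>\<^sub>1 (Suc n), 1:] * (g * P (Suc n)) - g * P (Suc (Suc n))"
    using P_three_term[of "Suc n"] gamma2_eq_h[of "Suc n"]
    by (simp add: right_diff_distrib ac_simps)
  also have "f dvd \<dots>" by (rule dvd_diff[OF dvd_mult[OF Suc.prems(2)] Suc.prems(1)])
  finally have "f dvd g * P n"
    using gamma2_pos[of "Suc n"] by (simp add: dvd_smult_iff)
  with Suc show ?case by simp
qed

text \<open>By Cramer's rule \<open>\<rho>\<close> divides the determinant times \<open>P n\<close>
  and times \<open>P (n - 1)\<close>, and these are coprime.\<close>

lemma rho_dvd_Delta: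
  assumes "n \<ge> 2"
  shows "\<rho> dvd \<Delta> n"
proof (rule dvd_if_dvd_mult_P[where n = "n - 1"])
  note e = connection[of n] connection_prev(1)[OF assms]
  have "\<Delta> n * P n = \<rho> * (D\<^sub>2 n * S n - B\<^sub>2 n * S (n - 1))"
    using e assms unfolding Delta_def by (simp add: algebra_simps) algebra
  moreover have "\<Delta> n * P (n - 1) = \<rho> * (A\<^sub>2 n * S (n - 1) - C\<^sub>2 n * S n)"
    using e assms unfolding Delta_def by (simp add: algebra_simps) algebra
  ultimately show "\<rho> dvd \<Delta> n * P (Suc (n - 1))" "\<rho> dvd \<Delta> n * P (n - 1)"
    using assms by simp_all
qed

lemma Delta_eq: "n \<ge> 2 \<Longrightarrow> \<Delta> n = \<rho> * \<delta> n"
  using rho_dvd_Delta by (simp add: delta_def)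

end

section \<open>Leading coefficients of the connection polynomials\<close>

context jacobi_sobolev
begin

text \<open>The coefficient of x^(d-1) in \<open>B2\<close>, evaluated by
  \<open>mass_P_sum\<close>.\<close>

definition b_top :: "nat \<Rightarrow> real" where
  "b_top n = (H n - h n) / h (n - 1)"

lemma taylor_sum_top_coeff:
  "top_coeff (pCons 0 (\<Sum>(j, k)\<in>I. smult (fact k * lam j k * poly_deriv_at k (S n) (c j) / r)
       (taylor_poly k (c j) f * \<rho>q j k))) dt
     ((\<Sum>(j, k)\<in>I. mass n (j, k) * poly_deriv_at k f (c j)) / r)"
proof -
  have "top_coeff (\<Sum>x\<in>I. pCons 0 (case x of (j, k) \<Rightarrow>
      smult (fact k * lam j k * poly_deriv_at k (S n) (c j) / r) (taylor_poly k (c j) f * \<rho>q j k))) dt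
     (\<Sum>x\<in>I. (case x of (j, k) \<Rightarrow> mass n (j, k) * poly_deriv_at k f (c j)) / r)"
  proof (rule top_coeff_sum)
    fix x assume "x \<in> I"
    then obtain j k where x: "x = (j, k)" "(j, k) \<in> I" by (cases x) auto
    have "top_coeff (smult (fact k * mass n (j, k) / r) (pCons 0 (taylor_poly k (c j) f * \<rho>q j k))) dt
        (fact k * mass n (j, k) / r * (poly_deriv_at k f (c j) / fact k))"
      by (intro top_coeff_smult top_coeff_taylor_rho_quot x)
    then show "top_coeff (pCons 0 (case x of (j, k) \<Rightarrow>
        smult (fact k * lam j k * poly_deriv_at k (S n) (c j) / r) (taylor_poly k (c j) f * \<rho>q j k))) dt
        ((case x of (j, k) \<Rightarrow> mass n (j, k) * poly_deriv_at k f (c j)) / r)"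
      by (simp add: x mass_def mult.assoc)
  qed
  then show ?thesis by (simp only: sum_pCons_0 sum_divide_distrib)
qed

lemma top_coeff_A2: "top_coeff (A\<^sub>2 n) dt 1"
  using top_coeff_diff[OF top_coeff_rho top_coeff_pCons_0_imp[OF taylor_sum_top_coeff]]
  by (simp add: A2_def)

lemma top_coeff_B2: "top_coeff (pCons 0 (B\<^sub>2 n)) dt (b_top n)"
  using taylor_sum_top_coeff[of n "h (n - 1)" "P n"] unfolding mass_P_sum b_top_def B2_def .

lemma top_coeff_A3:
  assumes "n \<ge> 1"
  shows "top_coeff (A\<^sub>3 n) (Suc dt) (- (real dt + real n))"
proof -
  have "top_coeff (a_hat \<alpha> \<beta> n) 1 (- real n)"
    unfolding J.a_hat_eq[OF assms] by (rule top_coeff_linear)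
  from top_coeff_mult[OF this top_coeff_A2]
  have "top_coeff (a_hat \<alpha> \<beta> n * A\<^sub>2 n) (Suc dt) (- real n)" by simp
  moreover have "top_coeff (smult (d_hat \<alpha> \<beta> n) (B\<^sub>2 n)) (Suc dt) 0"
    by (rule top_coeff_Suc[OF top_coeff_smult[OF top_coeff_pCons_0_imp[OF top_coeff_B2]]])
  ultimately show ?thesis
    using top_coeff_add[OF top_coeff_add[OF top_coeff_one_minus_x2_pderiv[OF top_coeff_A2]]]
    unfolding A3_def by fastforce
qed

text \<open>The coefficient of x^d in \<open>B3\<close>: its summands contribute -(d - 1)
  \<open>b_top\<close>, then \<open>b_hat\<close>, rewritten by \<open>gamma2\<close>, and (n +
  \<alpha> + \<beta>) \<open>b_top\<close>.\<close>

definition b3_top :: "nat \<Rightarrow> real" where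
  "b3_top n = (2 * real n + \<alpha> + \<beta> + 1) * \<gamma>\<^sub>2 n + (real n + \<alpha> + \<beta> - real dt + 1) * b_top n"

lemma top_coeff_B3:
  assumes "n \<ge> 1"
  shows "top_coeff (B\<^sub>3 n) dt (b3_top n)"
proof -
  have pos: "2 * real n + \<alpha> + \<beta> > 0" using assms alpha beta by simp
  have c: "top_coeff (c_hat \<alpha> \<beta> n) 1 (real n + \<alpha> + \<beta>)"
    using top_coeff_smult[OF top_coeff_linear[of "\<alpha> - \<beta>" "2 * real n + \<alpha> + \<beta>"],
        of "(real n + \<alpha> + \<beta>) / (2 * real n + \<alpha> + \<beta>)"] pos
    unfolding c_hat_def by simp
  have "top_coeff (c_hat \<alpha> \<beta> n * B\<^sub>2 n) dt ((real n + \<alpha> + \<beta>) * b_top n)"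
    using top_coeff_mult[OF c top_coeff_B2[of n]] by (simp add: top_coeff_pCons_0_iff)
  moreover have "top_coeff (smult (b_hat \<alpha> \<beta> n) (A\<^sub>2 n)) dt (b_hat \<alpha> \<beta> n * 1)"
    by (rule top_coeff_smult[OF top_coeff_A2])
  ultimately have "top_coeff (B\<^sub>3 n) dt
      (- ((real dt - 1) * b_top n) + b_hat \<alpha> \<beta> n * 1 + (real n + \<alpha> + \<beta>) * b_top n)"
    unfolding B3_def
    by (intro top_coeff_add top_coeff_one_minus_x2_pderiv' top_coeff_B2)
  then show ?thesis by (simp add: b3_top_def J.b_hat_eq[OF assms] algebra_simps)
qed

definition norm_ratio :: "nat \<Rightarrow> real" where
  "norm_ratio n = H n / h n"

lemma norm_ratio_pos: "norm_ratio n > 0"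
  by (simp add: norm_ratio_def H_pos h_pos)

lemma b_top_eq: "n \<ge> 1 \<Longrightarrow> b_top n = \<gamma>\<^sub>2 n * (norm_ratio n - 1)"
  using h_pos[of n] h_pos[of "n - 1"]
  by (simp add: b_top_def norm_ratio_def gamma2_eq_h field_simps)

context
  fixes n :: nat
  assumes n: "n \<ge> 2"
begin

abbreviation "m \<equiv> n - 1"
abbreviation "R \<equiv> norm_ratio m"
text \<open>The factor of \<open>b_top\<close> in \<open>b3_top\<close> at index n - 1.\<close>

abbreviation "\<tau> \<equiv> real n + \<alpha> + \<beta> - real dt"

lemma m_ge: "m \<ge> 1"
  using n by simp

lemma gamma2_neq_0: "\<gamma>\<^sub>2 m \<noteq> 0"
  using gamma2_pos[OF m_ge] by simp

lemma b3_div: "b3_top m / \<gamma>\<^sub>2 m = (2 * real n + \<alpha> + \<beta> - 1) + \<tau> * (R - 1)"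
  using gamma2_neq_0 m_ge by (simp add: b3_top_def b_top_eq field_simps of_nat_diff)

lemma top_coeff_C2: "top_coeff (pCons 0 (C\<^sub>2 n)) dt (1 - R)"
proof -
  have "pCons 0 (C\<^sub>2 n) = - smult (1 / \<gamma>\<^sub>2 m) (pCons 0 (B\<^sub>2 m))"
    by (simp add: C2_def)
  then show ?thesis
    using top_coeff_minus[OF top_coeff_smult[OF top_coeff_B2[of m], of "1 / \<gamma>\<^sub>2 m"]] gamma2_neq_0 m_ge
    by (simp add: b_top_eq)
qed

lemma top_coeff_C3: "top_coeff (C\<^sub>3 n) dt (- (2 * real n + \<alpha> + \<beta> - 1 + \<tau> * (R - 1)))"
  using top_coeff_minus[OF top_coeff_smult[OF top_coeff_B3[OF m_ge], of "1 / \<gamma>\<^sub>2 m"]] b3_div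
  by (simp add: C3_def)

lemma top_coeff_D2: "top_coeff (D\<^sub>2 n) dt R"
  using top_coeff_add[OF top_coeff_A2[of m] top_coeff_mult_linear[OF top_coeff_B2[of m], of "1 / \<gamma>\<^sub>2 m" "- \<gamma>\<^sub>1 m"]]
    gamma2_neq_0 m_ge
  by (simp add: D2_def b_top_eq)

text \<open>\<open>A3\<close> and x \<open>B3\<close> both reach degree d + 1; in the sum of their
  leading coefficients the part free of \<open>R\<close> cancels.\<close>

lemma top_coeff_D3: "top_coeff (D\<^sub>3 n) (Suc dt) (\<tau> * R)"
proof -
  have "top_coeff (pCons 0 (B\<^sub>3 m)) (Suc dt) (b3_top m)"
    using top_coeff_B3[OF m_ge] by (simp add: top_coeff_pCons_0_iff)
  from top_coeff_add[OF top_coeff_A3[OF m_ge] top_coeff_mult_linear[OF this, of "1 / \<gamma>\<^sub>2 m" "- \<gamma>\<^sub>1 m"]]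
  have "top_coeff (D\<^sub>3 n) (Suc dt) (- (real dt + real m) + b3_top m / \<gamma>\<^sub>2 m)"
    by (simp add: D3_def)
  also have "- (real dt + real m) + b3_top m / \<gamma>\<^sub>2 m = \<tau> * R"
    unfolding b3_div using m_ge by (simp add: of_nat_diff algebra_simps)
  finally show ?thesis .
qed

section \<open>Leading coefficients and degrees of the ladder polynomials\<close>

lemma top_coeff_Delta: "top_coeff (\<Delta> n) (2 * dt) R"
  using top_coeff_diff[OF top_coeff_mult[OF top_coeff_A2 top_coeff_D2]
      top_coeff_mult[OF top_coeff_pCons_0_imp[OF top_coeff_C2] top_coeff_pCons_0_imp[OF top_coeff_B2]]]
  by (simp add: Delta_def mult_2)

lemma top_coeff_delta: "top_coeff (\<delta> n) dt R"
  using top_coeff_mult_cancel[OF _ top_coeff_rho, of "\<delta> n" dt R] top_coeff_Delta norm_ratio_pos[of m]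
  by (simp add: Delta_eq[OF n] mult_2)

lemma top_coeff_rho_delta:
  "top_coeff (one_minus_x2 * pderiv \<rho> * \<delta> n) (Suc (2 * dt)) (- (real dt * R))"
  using top_coeff_mult[OF top_coeff_one_minus_x2_pderiv[OF top_coeff_rho] top_coeff_delta]
  by (simp add: mult_2)

lemma top_coeff_q0: "top_coeff (q\<^sub>0 n) (2 * dt + 2) (- R)"
proof -
  have "top_coeff one_minus_x2 2 (-1)"
    by (auto simp: top_coeff_def coeff_pCons numeral_2_eq_2 split: nat.split)
  from top_coeff_mult[OF this top_coeff_Delta] show ?thesis
    by (simp add: q0_def)
qed

text \<open>Both products contribute at x^(2d). Multiplying by x lets \<open>B2\<close> enter with
  its coefficient of x^(d-1); d cancels in the result.\<close>

lemma top_coeff_q1: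
  "top_coeff (q\<^sub>1 n) (2 * dt) ((2 * real n + \<alpha> + \<beta> + 1) * \<gamma>\<^sub>2 n * norm_ratio n)"
proof -
  have n1: "n \<ge> 1" using n by simp
  have "top_coeff (pCons 0 (B\<^sub>3 n) * A\<^sub>2 n - A\<^sub>3 n * pCons 0 (B\<^sub>2 n)) (Suc dt + dt)
      (b3_top n * 1 - (- (real dt + real n)) * b_top n)"
    by (intro top_coeff_diff top_coeff_mult top_coeff_A2 top_coeff_B2 top_coeff_A3[OF n1])
      (simp add: top_coeff_pCons_0_iff top_coeff_B3[OF n1])
  moreover have "pCons 0 (B\<^sub>3 n) * A\<^sub>2 n - A\<^sub>3 n * pCons 0 (B\<^sub>2 n) = pCons 0 (q\<^sub>1 n)"
    by (simp add: q1_def)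
  moreover have "b3_top n * 1 - (- (real dt + real n)) * b_top n =
      (2 * real n + \<alpha> + \<beta> + 1) * \<gamma>\<^sub>2 n * norm_ratio n"
    by (simp add: b3_top_def b_top_eq[OF n1] algebra_simps)
  ultimately show ?thesis
    by (simp only: mult_2 add_Suc top_coeff_pCons_0_iff)
qed

text \<open>At x^(2d+1) the term with \<rho>' gives -d \<open>R\<close> and -\<open>A3\<close>
  \<open>D2\<close> gives (d + n) \<open>R\<close>; the remaining product is too low.\<close>

lemma top_coeff_q2: "top_coeff (q\<^sub>2 n) (2 * dt + 1) (real n * R)"
proof -
  have n1: "n \<ge> 1" using n by simp
  have 1: "top_coeff (B\<^sub>3 n * C\<^sub>2 n) (Suc (2 * dt)) 0"
    using top_coeff_Suc[OF top_coeff_mult[OF top_coeff_B3[OF n1] top_coeff_pCons_0_imp[OF top_coeff_C2]]]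
    by (simp add: mult_2)
  have 2: "top_coeff (A\<^sub>3 n * D\<^sub>2 n) (Suc (2 * dt)) (- (real dt + real n) * R)"
    using top_coeff_mult[OF top_coeff_A3[OF n1] top_coeff_D2] by (simp add: mult_2)
  show ?thesis
    using top_coeff_diff[OF top_coeff_add[OF top_coeff_rho_delta 1] 2]
    by (simp add: q2_def algebra_simps)
qed

text \<open>Here -d \<open>R\<close> meets -\<open>\<tau>\<close> \<open>R\<close>, and d cancels
  again.\<close>

lemma top_coeff_q3:
  "top_coeff (q\<^sub>3 n) (2 * dt + 1) (- (real n + \<alpha> + \<beta>) * R)"
proof -
  have 1: "top_coeff (C\<^sub>3 n * B\<^sub>2 n) (Suc (2 * dt)) 0"
    using top_coeff_Suc[OF top_coeff_mult[OF top_coeff_C3 top_coeff_pCons_0_imp[OF top_coeff_B2]]]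
    by (simp add: mult_2)
  have 2: "top_coeff (D\<^sub>3 n * A\<^sub>2 n) (Suc (2 * dt)) (\<tau> * R)"
    using top_coeff_mult[OF top_coeff_D3 top_coeff_A2] by (simp add: mult_2)
  show ?thesis
    using top_coeff_diff[OF top_coeff_add[OF top_coeff_rho_delta 1] 2]
    by (simp add: q3_def algebra_simps)
qed

text \<open>As for \<open>q1\<close>, with all terms in \<open>\<tau>\<close> cancelling.\<close>

lemma top_coeff_q4:
  "top_coeff (q\<^sub>4 n) (2 * dt) (- (2 * real n + \<alpha> + \<beta> - 1) * R)"
proof -
  have "top_coeff (pCons 0 (C\<^sub>3 n) * D\<^sub>2 n - D\<^sub>3 n * pCons 0 (C\<^sub>2 n)) (Suc dt + dt)
      (- (2 * real n + \<alpha> + \<beta> - 1 + \<tau> * (R - 1)) * R - \<tau> * R * (1 - R))"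
    by (intro top_coeff_diff top_coeff_mult top_coeff_D2 top_coeff_D3 top_coeff_C2)
      (simp only: top_coeff_pCons_0_iff top_coeff_C3)
  moreover have "pCons 0 (C\<^sub>3 n) * D\<^sub>2 n - D\<^sub>3 n * pCons 0 (C\<^sub>2 n) = pCons 0 (q\<^sub>4 n)"
    by (simp add: q4_def)
  moreover have "- (2 * real n + \<alpha> + \<beta> - 1 + \<tau> * (R - 1)) * R - \<tau> * R * (1 - R) =
      - (2 * real n + \<alpha> + \<beta> - 1) * R"
    by algebra
  ultimately have "top_coeff (pCons 0 (q\<^sub>4 n)) (Suc (2 * dt)) (- (2 * real n + \<alpha> + \<beta> - 1) * R)"
    by (simp only: mult_2 add_Suc)
  then show ?thesis by (simp only: top_coeff_pCons_0_iff)
qed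

lemma degree_q:
  "degree (q\<^sub>0 n) = 2 * dt + 2"
  "degree (q\<^sub>1 n) = 2 * dt" "q\<^sub>1 n \<noteq> 0"
  "degree (q\<^sub>2 n) = 2 * dt + 1"
  "degree (q\<^sub>3 n) = 2 * dt + 1"
  "degree (q\<^sub>4 n) = 2 * dt" "q\<^sub>4 n \<noteq> 0"
proof -
  have R: "R \<noteq> 0" using norm_ratio_pos[of m] by simp
  have n2: "real n \<ge> 2" using n by simp
  note deg = top_coeff_imp_degree
  show "degree (q\<^sub>0 n) = 2 * dt + 2"
    using deg[OF top_coeff_q0] R by simp
  have "(2 * real n + \<alpha> + \<beta> + 1) * \<gamma>\<^sub>2 n * norm_ratio n \<noteq> 0"
    using n2 alpha beta gamma2_pos[of n] norm_ratio_pos[of n] n by auto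
  then show "degree (q\<^sub>1 n) = 2 * dt" "q\<^sub>1 n \<noteq> 0"
    using deg[OF top_coeff_q1] by blast+
  show "degree (q\<^sub>2 n) = 2 * dt + 1"
    using deg[OF top_coeff_q2] R n2 by simp
  \<comment> \<open>From n \<ge> 2 and \<alpha>, \<beta> > -1 follows n + \<alpha> + \<beta> > 0;
    likewise 2n + \<alpha> + \<beta> - 1 > 0 for \<open>q4\<close>.\<close>
  have "- (real n + \<alpha> + \<beta>) * R \<noteq> 0" using R n2 alpha beta by simp
  then show "degree (q\<^sub>3 n) = 2 * dt + 1"
    using deg[OF top_coeff_q3] by simp
  have "- (2 * real n + \<alpha> + \<beta> - 1) * R \<noteq> 0" using R n2 alpha beta by simp
  then show "degree (q\<^sub>4 n) = 2 * dt" "q\<^sub>4 n \<noteq> 0"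
    using deg[OF top_coeff_q4] by blast+
qed

section \<open>The ladder equations\<close>

lemma ladder_equations:
  "A4 \<alpha> \<beta> N ds c lam n * to_fract (S n) + B4 \<alpha> \<beta> N ds c lam n * to_fract (pderiv (S n))
     = to_fract (S (n - 1))"
  "C4 \<alpha> \<beta> N ds c lam n * to_fract (S (n - 1)) + D4 \<alpha> \<beta> N ds c lam n * to_fract (pderiv (S (n - 1)))
     = to_fract (S n)"
proof -
  have n1: "n \<ge> 1" using n by simp
  have det: "A\<^sub>2 n * D\<^sub>2 n - C\<^sub>2 n * B\<^sub>2 n = \<rho> * \<delta> n"
    using Delta_eq[OF n] by (simp add: Delta_def)
  \<comment> \<open>Elimination with s = S_n, t = S_(n-1), p = P_n and q = P_(n-1); the two
    derivative formulas are supplied below, and \<open>degree_q\<close> keeps the denominators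
    nonzero.\<close>
  note ladder = ladder_relation[OF rho_neq_0 det connection[OF n1] connection_prev(1)[OF n]]
  show "A4 \<alpha> \<beta> N ds c lam n * to_fract (S n) + B4 \<alpha> \<beta> N ds c lam n * to_fract (pderiv (S n))
     = to_fract (S (n - 1))"
    unfolding A4_def B4_def
    by (rule Fract_ladder[OF degree_q(3)])
      (use ladder(1)[OF connection_deriv[OF n1]] in \<open>simp only: q0_def q1_def q2_def Delta_eq[OF n]\<close>)
  show "C4 \<alpha> \<beta> N ds c lam n * to_fract (S (n - 1)) + D4 \<alpha> \<beta> N ds c lam n * to_fract (pderiv (S (n - 1)))
     = to_fract (S n)"
    unfolding C4_def D4_def
    by (rule Fract_ladder[OF degree_q(7)])
      (use ladder(2)[OF connection_prev(2)[OF n]] in \<open>simp only: q0_def q3_def q4_def Delta_eq[OF n]\<close>)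
qed

end

end

theorem theorem1:
  fixes \<alpha> \<beta> :: real and N :: nat and ds :: "nat \<Rightarrow> nat"
    and c :: "nat \<Rightarrow> real" and lam :: "nat \<Rightarrow> nat \<Rightarrow> real" and n :: nat
  defines "S \<equiv> sobolev_poly \<alpha> \<beta> N ds c lam"
    and "d \<equiv> d_total N ds"
  assumes "\<alpha> > -1" and "\<beta> > -1"
    and "\<And>j k. j \<in> {1..N} \<Longrightarrow> k \<le> ds j \<Longrightarrow> lam j k \<ge> 0"
    and "\<And>j. j \<in> {1..N} \<Longrightarrow> c j \<in> UNIV - {-1<..<1}"
    and "inj_on c {1..N}"
    and "\<And>j. j \<in> {1..N} \<Longrightarrow> (j, ds j) \<in> I_plus N ds lam"
    and "mono_on {1..N} ds"
    and "n \<ge> 2"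
  shows "rho N ds c dvd Delta \<alpha> \<beta> N ds c lam n \<and>
    q1 \<alpha> \<beta> N ds c lam n \<noteq> 0 \<and>
    q4 \<alpha> \<beta> N ds c lam n \<noteq> 0 \<and>
    A4 \<alpha> \<beta> N ds c lam n * to_fract (S n) + B4 \<alpha> \<beta> N ds c lam n * to_fract (pderiv (S n))
           = to_fract (S (n - 1)) \<and>
    C4 \<alpha> \<beta> N ds c lam n * to_fract (S (n - 1))
           + D4 \<alpha> \<beta> N ds c lam n * to_fract (pderiv (S (n - 1))) = to_fract (S n) \<and>
    degree (q0 \<alpha> \<beta> N ds c lam n) = 2 * d + 2 \<and>
    degree (q1 \<alpha> \<beta> N ds c lam n) = 2 * d \<and>
    degree (q2 \<alpha> \<beta> N ds c lam n) = 2 * d + 1 \<and>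
    degree (q3 \<alpha> \<beta> N ds c lam n) = 2 * d + 1 \<and>
    degree (q4 \<alpha> \<beta> N ds c lam n) = 2 * d"
proof -
  interpret jacobi_sobolev \<alpha> \<beta> N ds c lam
    by standard (fact assms)+
  show ?thesis
    unfolding S_def d_def
    using rho_dvd_Delta degree_q ladder_equations \<open>n \<ge> 2\<close> by blast
qed

end
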